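(* Let $d\ge2$. The set of hyperboloid mixtures $$\mathcal{M}_{\mathbb{L}^d}=\left\{\sum_{i=1}^n w_iP_{\theta_i}:\ n\ge1,\ \theta_1,\dots,\theta_n\in\Theta_{\mathbb{L}^d},\ w_i\ge0,\ \sum_{i=1}^nw_i=1\right\}$$ is dense in the space of (Borel) probability distributions on $\mathbb{L}^d$ for the topology of weak convergence.
   Context: The Minkowski inner product on $\mathbb{R}^{d+1}$ is $[x,y]=x_0y_0-x_1y_1-\cdots-x_dy_d$. $\mathbb{L}^d=\{x\in\mathbb{R}^{d+1}:x_0=\sqrt{1+x_1^2+\cdots+x_d^2}\}$, $\Theta_{\mathbb{L}^d}=\{\theta\in\mathbb{R}^{d+1}:\theta_0>\sqrt{\theta_1^2+\cdots+\theta_d^2}\}$, and $|\theta|=[\theta,\theta]^{1/2}$ for $\theta\in\Theta_{\mathbb{L}^d}$. For $x\in\mathbb{R}^d$ let $\widetilde x=\left(\sqrt{1+\sum_i x_i^2},x_1,\dots,x_d\right)\in\mathbb{L}^d$; the map $x\mapsto\widetilde x$ is a homeomorphism $\mathbb{R}^d\to\mathbb{L}^d$ by which $\mathbb{R}^d$ and $\mathbb{L}^d$ are identified. The hyperboloid distribution $P_\theta$, $\theta\in\Theta_{\mathbb{L}^d}$, is the probability measure on $\mathbb{R}^d$, regarded via this identification as a Borel probability measure on $\mathbb{L}^d$, with Lebesgue density on $\mathbb{R}^d$ $$p_\theta(x)=c_d(|\theta|)\,\frac{\exp(-[\theta,\widetilde x])}{\sqrt{1+\sum_i x_i^2}},\qquad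 c_d(t)=\frac{t^{(d-1)/2}}{2(2\pi)^{(d-1)/2}K_{(d-1)/2}(t)},\ t>0,$$ where $K_\nu$ is the modified Bessel function of the second kind. Weak convergence means convergence of integrals of bounded continuous functions. *)

theory Defs
  imports "HOL-Probability.Probability"
begin

text \<open>
  Vectors with \<open>d + 1\<close> real coordinates are modelled as pairs \<open>(x\<^sub>0, (x\<^sub>1, \<dots>, x\<^sub>d))\<close> in
  \<open>real \<times> (real ^ 'n)\<close>, where \<open>d = CARD('n)\<close>.
\<close>

definition minkowski :: "real \<times> (real ^ 'n) \<Rightarrow> real \<times> (real ^ 'n) \<Rightarrow> real" where
  "minkowski x y = fst x * fst y - (\<Sum>i\<in>UNIV. snd x $ i * snd y $ i)"

definition hyperboloid :: "(real \<times> (real ^ 'n)) set" where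
  "hyperboloid = {x. fst x = sqrt (1 + (\<Sum>i\<in>UNIV. (snd x $ i)\<^sup>2))}"

definition hyp_param_space :: "(real \<times> (real ^ 'n)) set" where
  "hyp_param_space = {\<theta>. fst \<theta> > sqrt (\<Sum>i\<in>UNIV. (snd \<theta> $ i)\<^sup>2)}"

definition minkowski_norm :: "real \<times> (real ^ 'n) \<Rightarrow> real" where
  "minkowski_norm \<theta> = sqrt (minkowski \<theta> \<theta>)"

definition hyp_lift :: "real ^ 'n \<Rightarrow> real \<times> (real ^ 'n)" where
  "hyp_lift x = (sqrt (1 + (\<Sum>i\<in>UNIV. (x $ i)\<^sup>2)), x)"

text \<open>
  The modified Bessel function of the second kind of real order \<open>\<nu>\<close> at real \<open>t > 0\<close>,
  given by its standard integral representation; it diverges (and the Bochner integral is \<open>0\<close>) for \<open>t \<le> 0\<close>.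
\<close>

definition bessel_K :: "real \<Rightarrow> real \<Rightarrow> real" where
  "bessel_K \<nu> t = (LBINT u:{0..}. exp (- t * cosh u) * cosh (\<nu> * u))"

definition hyp_const :: "nat \<Rightarrow> real \<Rightarrow> real" where
  "hyp_const d t =
     t powr ((real d - 1) / 2) /
     (2 * (2 * pi) powr ((real d - 1) / 2) * bessel_K ((real d - 1) / 2) t)"

definition hyp_density :: "real \<times> (real ^ 'n) \<Rightarrow> real ^ 'n \<Rightarrow> real" where
  "hyp_density \<theta> x =
     hyp_const CARD('n) (minkowski_norm \<theta>) *
     (exp (- minkowski \<theta> (hyp_lift x)) / sqrt (1 + (\<Sum>i\<in>UNIV. (x $ i)\<^sup>2)))"

text \<open>
  The identification of \<open>real ^ 'n\<close> with the hyperboloid is made explicit: the distribution is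
  the image under \<^const>\<open>hyp_lift\<close> of the measure with the given Lebesgue density.
\<close>

definition hyp_dist :: "real \<times> (real ^ 'n) \<Rightarrow> (real \<times> (real ^ 'n)) measure" where
  "hyp_dist \<theta> =
     distr (density lborel (\<lambda>x. ennreal (hyp_density \<theta> x)))
       (restrict_space borel hyperboloid) hyp_lift"

definition hyp_mixture ::
    "nat \<Rightarrow> (nat \<Rightarrow> real) \<Rightarrow> (nat \<Rightarrow> real \<times> (real ^ 'n)) \<Rightarrow> (real \<times> (real ^ 'n)) measure" where
  "hyp_mixture n w \<theta> =
     measure_of hyperboloid (sets (restrict_space borel hyperboloid))
       (\<lambda>A. \<Sum>i<n. ennreal (w i) * emeasure (hyp_dist (\<theta> i)) A)"

definition hyp_mixtures :: "(real \<times> (real ^ 'n)) measure set" where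
  "hyp_mixtures = {hyp_mixture n w \<theta> | n w \<theta>.
     n \<ge> 1 \<and> (\<forall>i<n. \<theta> i \<in> hyp_param_space) \<and> (\<forall>i<n. w i \<ge> 0) \<and> (\<Sum>i<n. w i) = 1}"

definition borel_probs :: "'a::topological_space set \<Rightarrow> 'a measure set" where
  "borel_probs X = {M. prob_space M \<and> sets M = sets (restrict_space borel X)}"

text \<open>
  The coarsest topology on the Borel probability measures on \<open>X\<close> for which
  \<open>M \<mapsto> \<integral> f dM\<close> is continuous for every bounded continuous \<open>f\<close> on \<open>X\<close>.
\<close>

definition weak_topology :: "'a::topological_space set \<Rightarrow> 'a measure topology" where
  "weak_topology X = topology_generated_by
     {{M \<in> borel_probs X. (LINT x|M. f x) \<in> U} | (f :: 'a \<Rightarrow> real) U.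
        continuous_on X f \<and> bounded (f ` X) \<and> open U}"

lemma topspace_weak_topology [simp]: "topspace (weak_topology X) = borel_probs X"
proof -
  have "borel_probs X \<in> {{M \<in> borel_probs X. (LINT x|M. f x) \<in> U} | (f :: 'a \<Rightarrow> real) U.
        continuous_on X f \<and> bounded (f ` X) \<and> open U}"
    by (rule CollectI, rule exI[of _ "\<lambda>_. 0"], rule exI[of _ UNIV]) (auto simp: bounded_iff)
  then show ?thesis
    unfolding weak_topology_def topology_generated_by_topspace by auto
qed

lemma space_hyp_dist [simp]: "space (hyp_dist \<theta>) = hyperboloid"
  and sets_hyp_dist [simp]: "sets (hyp_dist \<theta>) = sets (restrict_space borel hyperboloid)"
  by (simp_all add: hyp_dist_def space_restrict_space)

lemma sets_hyp_mixture [simp]: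
    "sets (hyp_mixture n w \<theta>) = sets (restrict_space borel hyperboloid)"
  using sets.sets_measure_of_eq[of "restrict_space borel hyperboloid"]
  unfolding hyp_mixture_def space_restrict_space by simp

lemma emeasure_hyp_mixture:
  assumes A: "A \<in> sets (restrict_space borel hyperboloid)"
  shows "emeasure (hyp_mixture n w \<theta>) A = (\<Sum>i<n. ennreal (w i) * emeasure (hyp_dist (\<theta> i)) A)"
proof (rule emeasure_measure_of[OF hyp_mixture_def])
  show "sets (restrict_space borel hyperboloid) \<subseteq> Pow hyperboloid"
    using sets.space_closed[of "restrict_space borel hyperboloid"]
    unfolding space_restrict_space by simp
  show "A \<in> sets (hyp_mixture n w \<theta>)" using A by simp
  show "positive (sets (hyp_mixture n w \<theta>)) (\<lambda>A. \<Sum>i<n. ennreal (w i) * emeasure (hyp_dist (\<theta> i)) A)"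
    by (simp add: positive_def)
  show "countably_additive (sets (hyp_mixture n w \<theta>))
      (\<lambda>A. \<Sum>i<n. ennreal (w i) * emeasure (hyp_dist (\<theta> i)) A)"
  proof (rule countably_additiveI)
    fix B :: "nat \<Rightarrow> (real \<times> (real ^ 'a)) set"
    assume B: "range B \<subseteq> sets (hyp_mixture n w \<theta>)" "disjoint_family B"
    have "(\<Sum>k. \<Sum>i<n. ennreal (w i) * emeasure (hyp_dist (\<theta> i)) (B k))
        = (\<Sum>i<n. \<Sum>k. ennreal (w i) * emeasure (hyp_dist (\<theta> i)) (B k))"
      by (rule suminf_sum) (rule summableI)
    also have "\<dots> = (\<Sum>i<n. ennreal (w i) * emeasure (hyp_dist (\<theta> i)) (\<Union>k. B k))"
      using B by (simp add: suminf_emeasure)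
    finally show "(\<Sum>k. \<Sum>i<n. ennreal (w i) * emeasure (hyp_dist (\<theta> i)) (B k))
        = (\<Sum>i<n. ennreal (w i) * emeasure (hyp_dist (\<theta> i)) (\<Union>k. B k))" .
  qed
qed

lemma measurable_hyp_lift [measurable]:
  "hyp_lift \<in> borel \<rightarrow>\<^sub>M restrict_space borel hyperboloid"
proof (rule measurable_restrict_space2)
  show "hyp_lift \<in> space borel \<rightarrow> hyperboloid"
    by (auto simp: hyp_lift_def hyperboloid_def)
  show "hyp_lift \<in> borel_measurable borel"
    unfolding hyp_lift_def by (intro borel_measurable_continuous_onI continuous_intros)
qed

end

theory Submission
  imports Defs
begin

text \<open>
  Any Borel probability measure is approximated, on finitely many bounded continuous functions, by
  finitely supported ones, so it suffices that \<open>P\<^sub>\<theta>\<close> with \<open>\<theta> = t m\<close> converges weakly to the point mass at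
  \<open>m\<close> as \<open>t \<rightarrow> \<infinity>\<close>. The density of \<open>P\<^bsub>t m\<^esub>\<close> is proportional to \<open>exp (- t ([m, x] - 1)) / x\<^sub>0\<close>, and
  \<open>[m, x] \<ge> 1\<close> with equality only at \<open>x = m\<close>, so this is Laplace's method.

  That the density has total mass \<open>1\<close> is shown without Lorentz invariance: writing
  \<open>exp (- \<theta>\<^sub>0 x\<^sub>0) / x\<^sub>0\<close> as a mixture of \<open>exp (- y x\<^sub>0\<^sup>2 / 2)\<close> over \<open>y > 0\<close> turns the integral over
  \<open>\<real>\<^sup>d\<close> into a Gaussian one, and what remains is the integral defining the Bessel function.
\<close>

subsection \<open>The normalising constant\<close>

text \<open>Completing the square makes the integrand a constant multiple of the normal density with
  mean \<open>b / y\<close> and variance \<open>1 / y\<close>.\<close>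

lemma nn_integral_gaussian_linear:
  fixes b y :: real
  assumes y: "y > 0"
  shows "(\<integral>\<^sup>+x. ennreal (exp (- (y * x\<^sup>2 / 2) + b * x)) \<partial>lborel)
           = ennreal (sqrt (2 * pi / y) * exp (b\<^sup>2 / (2 * y)))"
proof -
  define \<sigma> where "\<sigma> = 1 / sqrt y"
  have \<sigma>: "\<sigma> > 0" "\<sigma>\<^sup>2 = 1 / y" using y by (auto simp: \<sigma>_def power_divide)
  have *: "exp (- (y * x\<^sup>2 / 2) + b * x)
      = sqrt (2 * pi / y) * exp (b\<^sup>2 / (2 * y)) * normal_density (b / y) \<sigma> x" for x
  proof -
    have "- (y * x\<^sup>2 / 2) + b * x = b\<^sup>2 / (2 * y) + (- (x - b / y)\<^sup>2 / (2 * \<sigma>\<^sup>2))"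
      using y unfolding \<sigma> by (simp add: power2_eq_square field_simps)
    then show ?thesis
      using y \<sigma> by (simp add: normal_density_def flip: exp_add)
  qed
  have "(\<integral>\<^sup>+x. ennreal (normal_density (b / y) \<sigma> x) \<partial>lborel) = 1"
    using \<sigma> by (subst nn_integral_eq_integral) auto
  then show ?thesis
    unfolding * using y by (simp add: ennreal_mult' nn_integral_cmult)
qed

text \<open>In the orthonormal basis the exponent is a sum over coordinates, so the integral is a
  product of one-dimensional ones.\<close>

lemma nn_integral_gaussian_linear_euclidean:
  fixes b :: "'a :: euclidean_space" and y :: real
  assumes y: "y > 0"
  shows "(\<integral>\<^sup>+x. ennreal (exp (- (y * (x \<bullet> x) / 2) + b \<bullet> x)) \<partial>lborel)
           = ennreal (sqrt (2 * pi / y) ^ DIM('a) * exp ((b \<bullet> b) / (2 * y)))"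
proof -
  have "(\<integral>\<^sup>+x. ennreal (exp (- (y * (x \<bullet> x) / 2) + b \<bullet> x)) \<partial>lborel)
      = (\<integral>\<^sup>+x. (\<Prod>e\<in>Basis. ennreal (exp (- (y * (x \<bullet> e)\<^sup>2 / 2) + (b \<bullet> e) * (x \<bullet> e)))) \<partial>lborel)"
    by (intro nn_integral_cong, subst (1 2) euclidean_inner)
       (simp add: prod_ennreal power2_eq_square exp_sum[symmetric] sum.distrib sum_negf sum_subtractf
          sum_divide_distrib sum_distrib_left)
  also have "\<dots> = (\<Prod>e\<in>Basis. (\<integral>\<^sup>+x. ennreal (exp (- (y * x\<^sup>2 / 2) + (b \<bullet> e) * x)) \<partial>lborel))"
    by (rule nn_integral_lborel_prod) auto
  also have "\<dots> = (\<Prod>e\<in>Basis. ennreal (sqrt (2 * pi / y) * exp ((b \<bullet> e)\<^sup>2 / (2 * y))))"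
    by (simp only: nn_integral_gaussian_linear[OF y])
  also have "\<dots> = ennreal (sqrt (2 * pi / y) ^ DIM('a) * exp ((b \<bullet> b) / (2 * y)))"
    using y by (subst euclidean_inner)
       (simp add: prod_ennreal prod.distrib exp_sum sum_divide_distrib power2_eq_square)
  finally show ?thesis .
qed

section \<open>Hyperbolic substitutions on the real line\<close>

lemma nn_integral_reflect:
  assumes [measurable]: "f \<in> borel_measurable borel"
  shows "(\<integral>\<^sup>+x. f (- x) \<partial>lborel) = (\<integral>\<^sup>+x. f (x::real) \<partial>lborel)"
  using nn_integral_real_affine[of f "-1" 0] by simp

lemma borel_measurable_sinh_cosh [measurable]:
  shows "(sinh :: real \<Rightarrow> real) \<in> borel_measurable borel"
    and "(cosh :: real \<Rightarrow> real) \<in> borel_measurable borel"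
  by (intro borel_measurable_continuous_onI continuous_intros)+

text \<open>The substitution w = sinh u is a bijection of the line with dw = cosh u du, and it
  leaves the integral of the Gaussian exp (- z w^2).\<close>

lemma nn_integral_cosh_gaussian_sinh:
  assumes z: "z > 0"
  shows "(\<integral>\<^sup>+u. ennreal (cosh u * exp (- (z * (sinh u)\<^sup>2))) \<partial>lborel) = ennreal (sqrt (pi / z))"
proof -
  define F :: "real \<Rightarrow> real" where "F = (\<lambda>w. exp (- (z * w\<^sup>2)))"
  have [measurable]: "F \<in> borel_measurable borel" by (simp add: F_def)
  have nF: "(\<integral>\<^sup>+x. ennreal (F x) \<partial>lborel) = ennreal (sqrt (pi / z))"
    using nn_integral_gaussian_linear[of "2 * z" 0] z by (simp add: F_def)
  have intF: "integrable lborel F" and valF: "integral\<^sup>L lborel F = sqrt (pi / z)"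
    using nF z by (auto intro!: integrableI_nonneg integral_eq_nn_integral[THEN trans]
        simp: F_def)
  \<comment> \<open>The change of variables theorem speaks of absolute integrability and the gauge
    integral, so the value is carried to \<open>lebesgue\<close> and brought back to
    \<open>lborel\<close> afterwards.\<close>
  have "set_integrable lebesgue UNIV F"
    using intF by (simp add: set_integrable_def integrable_completion)
  moreover have "integral UNIV F = sqrt (pi / z)"
    using intF valF by (metis has_integral_integral_lborel integral_unique)
  moreover have "range sinh = (UNIV :: real set)"
    by (metis surjI sinh_arsinh_real)
  ultimately have *: "(\<lambda>u. \<bar>cosh u\<bar> * F (sinh u)) absolutely_integrable_on UNIV \<and>
      integral UNIV (\<lambda>u. \<bar>cosh u\<bar> * F (sinh u)) = sqrt (pi / z)"
    by (subst has_absolute_integral_change_of_variables_1')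
       (auto intro!: derivative_eq_intros simp: inj_on_def)
  have int: "integrable lborel (\<lambda>u. cosh u * F (sinh u))"
    using * by (simp add: set_integrable_def integrable_completion)
  then have "integral\<^sup>L lborel (\<lambda>u. cosh u * F (sinh u)) = sqrt (pi / z)"
    using * by (metis (no_types, lifting) abs_of_nonneg cosh_real_nonneg ext has_integral_integral_lborel integral_unique)
  then show ?thesis
    using nn_integral_eq_integral[OF int] by (simp add: F_def)
qed

text \<open>Since \<open>sinh\<close> enters only squared, adding the reflected integral replaces
  \<open>exp u\<close> by \<open>2 * cosh u\<close>.\<close>

lemma nn_integral_exp_gaussian_sinh:
  assumes z: "z > 0"
  shows "(\<integral>\<^sup>+u. ennreal (exp u * exp (- (z * (sinh u)\<^sup>2))) \<partial>lborel) = ennreal (sqrt (pi / z))"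
    (is "?I = _")
proof -
  have "?I = (\<integral>\<^sup>+u. ennreal (exp (- u) * exp (- (z * (sinh u)\<^sup>2))) \<partial>lborel)"
    using nn_integral_reflect[of "\<lambda>u. ennreal (exp u * exp (- (z * (sinh u)\<^sup>2)))"] by simp
  then have "?I + ?I = (\<integral>\<^sup>+u. ennreal (exp u * exp (- (z * (sinh u)\<^sup>2)))
      + ennreal (exp (- u) * exp (- (z * (sinh u)\<^sup>2))) \<partial>lborel)"
    by (subst nn_integral_add) auto
  also have "\<dots> = (\<integral>\<^sup>+u. ennreal 2 * ennreal (cosh u * exp (- (z * (sinh u)\<^sup>2))) \<partial>lborel)"
  proof (intro nn_integral_cong)
    fix u :: real
    let ?g = "exp (- (z * (sinh u)\<^sup>2))"
    have "exp u * ?g + exp (- u) * ?g = 2 * (cosh u * ?g)"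
      by (simp add: cosh_field_def distrib_right)
    then show "ennreal (exp u * ?g) + ennreal (exp (- u) * ?g) = ennreal 2 * ennreal (cosh u * ?g)"
      by (metis ennreal_mult' ennreal_plus exp_ge_zero mult_nonneg_nonneg zero_le_numeral)
  qed
  also have "\<dots> = 2 * ennreal (sqrt (pi / z))"
    using z by (subst nn_integral_cmult) (auto simp: nn_integral_cosh_gaussian_sinh)
  finally have "2 * ?I = 2 * ennreal (sqrt (pi / z))" by (simp add: mult_2)
  then show ?thesis by (simp add: ennreal_mult_cancel_left)
qed

text \<open>The mixture representation, with \<open>y = exp v\<close>. Centring \<open>v\<close> at \<open>ln (a / s)\<close> turns the exponent
  into \<open>- a s cosh (2 u) = - a s (1 + 2 (sinh u)\<^sup>2)\<close>.\<close>

lemma nn_integral_exp_half_Laplace: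
  fixes a s :: real
  assumes a: "a > 0" and s: "s > 0"
  shows "(\<integral>\<^sup>+v. ennreal (exp (v / 2 - (exp v * s\<^sup>2 + a\<^sup>2 * exp (- v)) / 2)) \<partial>lborel)
           = ennreal (sqrt (2 * pi) * (exp (- a * s) / s))"
proof -
  \<comment> \<open>The integrand after v = ln (a / s) + 2 u: the term v / 2 supplies both
    \<open>exp u\<close> and \<open>sqrt (a / s)\<close>, and the Jacobian 2 appears below.\<close>
  have *: "exp ((ln (a / s) + 2 * u) / 2 -
              (exp (ln (a / s) + 2 * u) * s\<^sup>2 + a\<^sup>2 * exp (- (ln (a / s) + 2 * u))) / 2)
      = sqrt (a / s) * exp (- a * s) * (exp u * exp (- ((2 * a * s) * (sinh u)\<^sup>2)))" for u
  proof -
    have e1: "exp (ln (a / s) / 2) = sqrt (a / s)"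
      using a s by (intro real_sqrt_unique[symmetric]) (simp_all flip: exp_double)
    have E: "exp (ln (a / s)) = a / s" using a s by simp
    have "exp (ln (a / s) + 2 * u) * s\<^sup>2 = a * s * exp (2 * u)"
      unfolding exp_add E using s by (simp add: power2_eq_square)
    moreover have "a\<^sup>2 * exp (- (ln (a / s) + 2 * u)) = a * s * exp (- (2 * u))"
      unfolding minus_add_distrib exp_add exp_minus[of "ln (a / s)"] E
      using a s by (simp add: power2_eq_square)
    moreover have "exp (2 * u) + exp (- (2 * u)) = 2 + 4 * (sinh u)\<^sup>2"
      using cosh_double[of u] cosh_square_eq[of u] unfolding cosh_field_def[of "2 * u"] by simp
    moreover have "(a * s * p + a * s * q) / 2 = a * s + 2 * a * s * h" if "p + q = 2 + 4 * h"
      for p q h :: real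
    proof -
      have "(a * s * p + a * s * q) / 2 = a * s * (p + q) / 2" by (simp add: algebra_simps)
      then show ?thesis unfolding that by (simp add: algebra_simps)
    qed
    ultimately have "(exp (ln (a / s) + 2 * u) * s\<^sup>2 + a\<^sup>2 * exp (- (ln (a / s) + 2 * u))) / 2
        = a * s + 2 * a * s * (sinh u)\<^sup>2"
      by presburger
    then have "exp ((ln (a / s) + 2 * u) / 2 -
              (exp (ln (a / s) + 2 * u) * s\<^sup>2 + a\<^sup>2 * exp (- (ln (a / s) + 2 * u))) / 2)
      = exp (ln (a / s) / 2 + (- a * s) + u + (- ((2 * a * s) * (sinh u)\<^sup>2)))"
      by (simp add: field_simps)
    then show ?thesis unfolding exp_add e1 by (simp add: mult_ac)
  qed
  have "(\<integral>\<^sup>+v. ennreal (exp (v / 2 - (exp v * s\<^sup>2 + a\<^sup>2 * exp (- v)) / 2)) \<partial>lborel)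
      = 2 * (\<integral>\<^sup>+u. ennreal (sqrt (a / s) * exp (- a * s) *
              (exp u * exp (- ((2 * a * s) * (sinh u)\<^sup>2)))) \<partial>lborel)"
    by (subst nn_integral_real_affine[where c = 2 and t = "ln (a / s)"]) (auto simp only: * abs_numeral ennreal_numeral, measurable)
  also have "\<dots> = 2 * (ennreal (sqrt (a / s) * exp (- a * s)) * ennreal (sqrt (pi / (2 * a * s))))"
    using a s by (simp only: ennreal_mult' exp_ge_zero mult_nonneg_nonneg real_sqrt_ge_zero
        divide_nonneg_nonneg less_imp_le)
      (subst nn_integral_cmult, simp, subst ennreal_mult'[symmetric], simp,
        subst nn_integral_exp_gaussian_sinh, auto)
  also have "\<dots> = ennreal (2 * (sqrt (a / s) * exp (- a * s) * sqrt (pi / (2 * a * s))))"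
    using a s by (simp add: ennreal_mult')
  also have "2 * (sqrt (a / s) * exp (- a * s) * sqrt (pi / (2 * a * s)))
      = sqrt (2 * pi) * (exp (- a * s) / s)"
  proof -
    have "sqrt (a / s) * sqrt (pi / (2 * a * s)) = sqrt (2 * pi / (4 * s\<^sup>2))"
      using a s by (simp add: power2_eq_square flip: real_sqrt_mult)
    also have "\<dots> = sqrt (2 * pi) / (2 * s)"
      using s by (intro real_sqrt_unique) (simp_all add: power_divide power_mult_distrib)
    finally have "2 * exp (- a * s) * (sqrt (a / s) * sqrt (pi / (2 * a * s)))
        = 2 * exp (- a * s) * (sqrt (2 * pi) / (2 * s))" by (rule arg_cong)
    then show ?thesis by (simp add: mult_ac)
  qed
  finally show ?thesis .
qed

section \<open>The Bessel integral over the whole line\<close>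

text \<open>Symmetrising the integrand in u yields \<open>cosh (\<nu> * u)\<close>, and folding the
  even result at 0 gives twice the integral in \<open>bessel_K\<close>. The latter is a Bochner
  integral, so finiteness has to be shown before the two values can be identified.\<close>

lemma nn_integral_bessel_K:
  fixes \<nu> t :: real
  assumes t: "t > 0"
  shows "(\<integral>\<^sup>+u. ennreal (exp (- (\<nu> * u) - t * cosh u)) \<partial>lborel) = ennreal (2 * bessel_K \<nu> t)"
    and "bessel_K \<nu> t > 0"
proof -
  let ?e = "\<lambda>u. ennreal (exp (- (\<nu> * u) - t * cosh u))"
  let ?h = "\<lambda>u. exp (- t * cosh u) * cosh (\<nu> * u)"
  let ?J = "\<integral>\<^sup>+u. ?e u \<partial>lborel"
  let ?H = "\<integral>\<^sup>+u. ennreal (indicator {0..} u * ?h u) \<partial>lborel"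
  have "?J + ?J = ?J + (\<integral>\<^sup>+u. ?e (- u) \<partial>lborel)"
    using nn_integral_reflect[of ?e] by simp
  also have "\<dots> = (\<integral>\<^sup>+u. ?e u + ?e (- u) \<partial>lborel)"
    by (subst nn_integral_add) auto
  also have "\<dots> = (\<integral>\<^sup>+u. ennreal 2 * ennreal (?h u) \<partial>lborel)"
  proof (intro nn_integral_cong)
    fix u
    have "exp (- (\<nu> * u) - t * cosh u) + exp (- (\<nu> * - u) - t * cosh (- u)) = 2 * ?h u"
      by (simp add: cosh_field_def[of "\<nu> * u"] exp_diff exp_minus field_simps)
    then show "?e u + ?e (- u) = ennreal 2 * ennreal (?h u)"
      by (metis ennreal_mult' ennreal_plus exp_ge_zero zero_le_numeral)
  qed
  also have "\<dots> = ennreal 2 * (\<integral>\<^sup>+u. ennreal (?h u) \<partial>lborel)"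
    by (rule nn_integral_cmult) measurable
  finally have "2 * ?J = 2 * (\<integral>\<^sup>+u. ennreal (?h u) \<partial>lborel)"
    unfolding mult_2[of ?J] by simp
  then have "?J = (\<integral>\<^sup>+u. ennreal (?h u) \<partial>lborel)"
    using ennreal_mult_cancel_left[of 2 ?J] by simp
  also have "\<dots> = (\<integral>\<^sup>+u. ennreal (indicator {0..} u * ?h u) + ennreal (indicator {0..} (- u) * ?h (- u)) \<partial>lborel)"
  proof (rule nn_integral_cong_AE)
    \<comment> \<open>At \<open>u = 0\<close> both indicators are 1 and the right side counts the
      value twice, so the identity holds only off a null set.\<close>
    have "AE u in lborel. u \<noteq> (0 :: real)" by (rule AE_lborel_singleton)
    then show "AE u in lborel. ennreal (?h u)
        = ennreal (indicator {0..} u * ?h u) + ennreal (indicator {0..} (- u) * ?h (- u))"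
    proof eventually_elim
      case (elim u)
      then show ?case by (cases "u > 0") simp_all
    qed
  qed
  also have "\<dots> = ?H + (\<integral>\<^sup>+u. ennreal (indicator {0..} (- u) * ?h (- u)) \<partial>lborel)"
    by (subst nn_integral_add) auto
  also have "\<dots> = 2 * ?H"
    using nn_integral_reflect[of "\<lambda>u. ennreal (indicator {0..} u * ?h u)"] by (simp add: mult_2)
  finally have JH: "?J = 2 * ?H" .

  \<comment> \<open>The quadratic minorant of \<open>cosh\<close> bounds the integrand by a Gaussian
    with a linear term, hence the integral is finite for every real order.\<close>
  have cosh_ge: "1 + u\<^sup>2 / 4 \<le> cosh u" for u :: real
  proof -
    have "1 + \<bar>u\<bar> + \<bar>u\<bar>\<^sup>2 / 2 \<le> exp \<bar>u\<bar>" "1 - \<bar>u\<bar> \<le> exp (- \<bar>u\<bar>)"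
      using exp_lower_Taylor_quadratic[of "\<bar>u\<bar>"] exp_ge_add_one_self[of "- \<bar>u\<bar>"] by simp_all
    then have "1 + u\<^sup>2 / 4 \<le> cosh \<bar>u\<bar>"
      unfolding cosh_field_def power2_abs by (simp add: field_simps)
    then show ?thesis by simp
  qed
  have "?e u \<le> ennreal (exp (- (t / 2 * u\<^sup>2 / 2) + (- \<nu>) * u))" for u
  proof -
    have "u\<^sup>2 / 4 \<le> cosh u" using cosh_ge[of u] by linarith
    then have "t * (u\<^sup>2 / 4) \<le> t * cosh u" using t by (intro mult_left_mono) simp_all
    then show ?thesis by (intro ennreal_leI) simp
  qed
  then have "?J \<le> (\<integral>\<^sup>+u. ennreal (exp (- (t / 2 * u\<^sup>2 / 2) + (- \<nu>) * u)) \<partial>lborel)"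
    by (intro nn_integral_mono)
  also have "\<dots> < \<infinity>"
    using t by (subst nn_integral_gaussian_linear) simp_all
  finally have Hfin: "?H < \<infinity>" unfolding JH by (auto simp: ennreal_mult_less_top)
  then have "integrable lborel (\<lambda>u. indicator {0..} u * ?h u)"
    by (intro integrableI_nonneg) (auto simp: indicator_def)
  then have "?H = ennreal (bessel_K \<nu> t)"
    unfolding bessel_K_def set_lebesgue_integral_def
    by (subst nn_integral_eq_integral) (auto simp: indicator_def)
  then show J2: "?J = ennreal (2 * bessel_K \<nu> t)" unfolding JH by (simp add: ennreal_mult')
  \<comment> \<open>The integrand is positive everywhere, so a vanishing integral would make
    Lebesgue measure trivial.\<close>
  have "?J \<noteq> 0"
  proof
    assume "?J = 0"
    then have "AE u in lborel. ?e u = 0" by (subst (asm) nn_integral_0_iff_AE) auto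
    then have "AE u in (lborel :: real measure). False" by simp
    then show False
      using ae_filter_eq_bot_iff[of "lborel :: real measure"] by (simp add: trivial_limit_def)
  qed
  then show "bessel_K \<nu> t > 0" unfolding J2 by (simp add: ennreal_eq_0_iff)
qed

section \<open>The Laplace integral over the hyperboloid\<close>

text \<open>Here \<open>(a, b)\<close> is a parameter and \<open>t\<close> its Minkowski norm.
  Integrating the Gaussian in x first produces \<open>exp ((b \<bullet> b) / (2 * exp v))\<close>,
  which lowers a^2 to t^2 in the mixing exponent. The parameter thus enters the result through
  \<open>t\<close> only.\<close>

lemma nn_integral_hyperboloid_Laplace:
  fixes a :: real and b :: "'a :: euclidean_space"
  assumes a: "a > 0" and t: "t > 0" and t2: "t\<^sup>2 = a\<^sup>2 - b \<bullet> b"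
  defines "\<nu> \<equiv> (real DIM('a) - 1) / 2"
  shows "(\<integral>\<^sup>+x. ennreal (exp (- (a * sqrt (1 + x \<bullet> x) - b \<bullet> x)) / sqrt (1 + x \<bullet> x)) \<partial>lborel)
      = ennreal (2 * (2 * pi) powr \<nu> * bessel_K \<nu> t / t powr \<nu>)" (is "?I = _")
proof -
  \<comment> \<open>The joint integrand of the mixture representation, with mixing variable y = exp
    v. The factor \<open>sqrt (2 * pi)\<close> put in front of \<open>?I\<close> is the constant of
    that representation and cancels at the end.\<close>
  define G where "G = (\<lambda>x v. exp (v / 2 - (exp v * (1 + x \<bullet> x) + a\<^sup>2 * exp (- v)) / 2 + b \<bullet> x))"
  have "ennreal (sqrt (2 * pi)) * ?I
      = (\<integral>\<^sup>+x. ennreal (sqrt (2 * pi)) * ennreal (exp (- (a * sqrt (1 + x \<bullet> x) - b \<bullet> x)) / sqrt (1 + x \<bullet> x)) \<partial>lborel)"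
    by (rule nn_integral_cmult[symmetric]) measurable
  also have "\<dots> = (\<integral>\<^sup>+x. (\<integral>\<^sup>+v. ennreal (G x v) \<partial>lborel) \<partial>lborel)"
  proof (intro nn_integral_cong)
    fix x :: 'a
    define s where "s = sqrt (1 + x \<bullet> x)"
    have s: "s > 0" "s\<^sup>2 = 1 + x \<bullet> x" by (auto simp: s_def add_pos_nonneg add_nonneg_nonneg)
    have "(\<integral>\<^sup>+v. ennreal (G x v) \<partial>lborel) = (\<integral>\<^sup>+v. ennreal (exp (b \<bullet> x)) *
        ennreal (exp (v / 2 - (exp v * s\<^sup>2 + a\<^sup>2 * exp (- v)) / 2)) \<partial>lborel)"
      by (intro nn_integral_cong) (simp add: G_def s exp_add mult.commute flip: ennreal_mult')
    also have "\<dots> = ennreal (exp (b \<bullet> x)) * ennreal (sqrt (2 * pi) * (exp (- a * s) / s))"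
      using nn_integral_exp_half_Laplace[OF a s(1)] by (subst nn_integral_cmult) auto
    also have "\<dots> = ennreal (sqrt (2 * pi)) * ennreal (exp (- (a * s - b \<bullet> x)) / s)"
    proof -
      have "exp (- (a * s - b \<bullet> x)) = exp (b \<bullet> x) * exp (- a * s)"
        by (simp flip: exp_add)
      then show ?thesis by (simp add: mult_ac flip: ennreal_mult')
    qed
    finally show "ennreal (sqrt (2 * pi)) * ennreal (exp (- (a * sqrt (1 + x \<bullet> x) - b \<bullet> x)) / sqrt (1 + x \<bullet> x))
        = (\<integral>\<^sup>+v. ennreal (G x v) \<partial>lborel)" by (simp only: s_def)
  qed
  also have "\<dots> = (\<integral>\<^sup>+v. (\<integral>\<^sup>+x. ennreal (G x v) \<partial>lborel) \<partial>lborel)"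
    unfolding G_def by (rule lborel_pair.Fubini'[symmetric]) measurable
  also have "\<dots> = (\<integral>\<^sup>+v. ennreal (sqrt (2 * pi) ^ DIM('a)) *
      ennreal (exp (- (\<nu> * v) - (exp v + t\<^sup>2 * exp (- v)) / 2)) \<partial>lborel)"
  proof (intro nn_integral_cong)
    fix v :: real
    have ev: "exp v > 0" by simp
    \<comment> \<open>The Gaussian contributes y^(- d / 2) and the mixture y^(1 / 2); together they
      are \<open>exp (- (\<nu> * v))\<close>, which is the source of the Bessel order (d - 1) /
      2.\<close>
    have sq: "sqrt (2 * pi / exp v) ^ DIM('a) = sqrt (2 * pi) ^ DIM('a) * exp (- (real DIM('a) * v / 2))"
    proof -
      have "sqrt (2 * pi / exp v) = sqrt (2 * pi) * exp (- (v / 2))"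
        by (intro real_sqrt_unique) (simp_all add: power_mult_distrib exp_minus field_simps flip: exp_double)
      then show ?thesis by (simp add: power_mult_distrib flip: exp_of_nat_mult)
    qed
    have "(\<integral>\<^sup>+x. ennreal (G x v) \<partial>lborel)
        = (\<integral>\<^sup>+x. ennreal (exp (v / 2 - (exp v + a\<^sup>2 * exp (- v)) / 2)) *
            ennreal (exp (- (exp v * (x \<bullet> x) / 2) + b \<bullet> x)) \<partial>lborel)"
      by (intro nn_integral_cong)
         (simp add: G_def algebra_simps add_divide_distrib flip: ennreal_mult' exp_add)
    also have "\<dots> = ennreal (exp (v / 2 - (exp v + a\<^sup>2 * exp (- v)) / 2)) *
        ennreal (sqrt (2 * pi / exp v) ^ DIM('a) * exp ((b \<bullet> b) / (2 * exp v)))"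
      by (subst nn_integral_cmult) (simp_all only: nn_integral_gaussian_linear_euclidean[OF ev], measurable)
    also have "\<dots> = ennreal (sqrt (2 * pi) ^ DIM('a)) *
      ennreal (exp (- (\<nu> * v) - (exp v + t\<^sup>2 * exp (- v)) / 2))"
    proof -
      have "v / 2 - (exp v + a\<^sup>2 * exp (- v)) / 2 + (- (real DIM('a) * v / 2)) + (b \<bullet> b) / (2 * exp v)
          = - (\<nu> * v) - (exp v + t\<^sup>2 * exp (- v)) / 2"
        by (simp add: \<nu>_def t2 exp_minus field_simps)
      then show ?thesis
        unfolding sq by (simp add: mult_ac flip: ennreal_mult' exp_add)
    qed
    finally show "(\<integral>\<^sup>+x. ennreal (G x v) \<partial>lborel) = ennreal (sqrt (2 * pi) ^ DIM('a)) *
      ennreal (exp (- (\<nu> * v) - (exp v + t\<^sup>2 * exp (- v)) / 2))" .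
  qed
  also have "\<dots> = ennreal (sqrt (2 * pi) ^ DIM('a)) *
      (\<integral>\<^sup>+v. ennreal (exp (- (\<nu> * v) - (exp v + t\<^sup>2 * exp (- v)) / 2)) \<partial>lborel)"
    by (rule nn_integral_cmult) measurable
  also have "(\<integral>\<^sup>+v. ennreal (exp (- (\<nu> * v) - (exp v + t\<^sup>2 * exp (- v)) / 2)) \<partial>lborel)
      = (\<integral>\<^sup>+u. ennreal (1 / t powr \<nu>) * ennreal (exp (- (\<nu> * u) - t * cosh u)) \<partial>lborel)"
  proof -
    \<comment> \<open>The shift v = ln t + u balances the two exponentials into
      \<open>t * cosh u\<close> and releases the factor \<open>1 / t powr \<nu>\<close>.\<close>
    have E: "exp (ln t) = t" using t by simp
    have "exp (- (\<nu> * (ln t + 1 * u)) - (exp (ln t + 1 * u) + t\<^sup>2 * exp (- (ln t + 1 * u))) / 2)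
        = 1 / t powr \<nu> * exp (- (\<nu> * u) - t * cosh u)" for u
    proof -
      have "(exp (ln t + 1 * u) + t\<^sup>2 * exp (- (ln t + 1 * u))) / 2 = t * cosh u"
        unfolding minus_add_distrib exp_add exp_minus[of "ln t"] E
        using t by (simp add: cosh_field_def power2_eq_square field_simps)
      moreover have "1 / t powr \<nu> = exp (- (\<nu> * ln t))"
        using t by (simp add: powr_def exp_minus divide_inverse)
      ultimately show ?thesis by (simp add: algebra_simps flip: exp_add)
    qed
    note shift = this
    have "(\<integral>\<^sup>+v. ennreal (exp (- (\<nu> * v) - (exp v + t\<^sup>2 * exp (- v)) / 2)) \<partial>lborel)
      = ennreal \<bar>1\<bar> * (\<integral>\<^sup>+u. ennreal (exp (- (\<nu> * (ln t + 1 * u))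
          - (exp (ln t + 1 * u) + t\<^sup>2 * exp (- (ln t + 1 * u))) / 2)) \<partial>lborel)"
      by (rule nn_integral_real_affine) simp_all
    also have "\<dots> = (\<integral>\<^sup>+u. ennreal (1 / t powr \<nu> * exp (- (\<nu> * u) - t * cosh u)) \<partial>lborel)"
      unfolding shift by simp
    finally show ?thesis by (simp only: ennreal_mult'' exp_ge_zero)
  qed
  also have "\<dots> = ennreal (1 / t powr \<nu>) * ennreal (2 * bessel_K \<nu> t)"
    by (subst nn_integral_cmult) (simp_all add: nn_integral_bessel_K[OF t])
  finally have "ennreal (sqrt (2 * pi)) * ?I
      = ennreal (sqrt (2 * pi) ^ DIM('a)) * (ennreal (1 / t powr \<nu>) * ennreal (2 * bessel_K \<nu> t))" .
  also have "\<dots> = ennreal (sqrt (2 * pi)) * ennreal (2 * (2 * pi) powr \<nu> * bessel_K \<nu> t / t powr \<nu>)"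
  proof -
    have "sqrt (2 * pi) ^ DIM('a) = sqrt (2 * pi) * (2 * pi) powr \<nu>"
      by (simp add: powr_half_sqrt[symmetric] powr_powr powr_realpow[symmetric] \<nu>_def
          powr_add[symmetric] field_simps)
    then show ?thesis
      using nn_integral_bessel_K(2)[OF t, of \<nu>] by (simp flip: ennreal_mult')
  qed
  finally show ?thesis
    by (simp add: ennreal_mult_cancel_left)
qed

subsection \<open>Tilted measures, finite samples and weak neighbourhoods\<close>

text \<open>Where \<phi> \<ge> \<delta> the weight is at most exp (- n \<delta>), while the
  normaliser is at least q exp (- n \<delta> / 2), with q the probability of \<phi> < \<delta> / 2.
  The share of the far region therefore decays exponentially, and on the near region
  \<open>g\<close> is close to \<open>l\<close>.\<close>

lemma (in prob_space) tilted_expectation_tendsto: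
  fixes \<phi> g :: "'a \<Rightarrow> real"
  assumes [measurable]: "\<phi> \<in> borel_measurable M" "g \<in> borel_measurable M"
    and nonneg: "\<And>x. x \<in> space M \<Longrightarrow> 0 \<le> \<phi> x"
    and bound: "\<And>x. x \<in> space M \<Longrightarrow> \<bar>g x\<bar> \<le> B"
    and pos: "\<And>\<delta>. \<delta> > 0 \<Longrightarrow> prob {x \<in> space M. \<phi> x < \<delta>} > 0"
    and lim: "\<And>\<epsilon>. \<epsilon> > 0 \<Longrightarrow> \<exists>\<delta>>0. \<forall>x\<in>space M. \<phi> x < \<delta> \<longrightarrow> \<bar>g x - l\<bar> < \<epsilon>"
  shows "(\<lambda>n. expectation (\<lambda>x. exp (- real n * \<phi> x) * g x) / expectation (\<lambda>x. exp (- real n * \<phi> x)))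
           \<longlonglongrightarrow> l"
proof -
  define Z where "Z n = expectation (\<lambda>x. exp (- real n * \<phi> x))" for n
  define N where "N n = expectation (\<lambda>x. exp (- real n * \<phi> x) * g x)" for n
  have B0: "B \<ge> 0"
    using bound not_empty abs_ge_zero order_trans by (metis ex_in_conv)
  have exp_le: "exp (- real n * \<phi> x) \<le> 1" if "x \<in> space M" for n x
    using nonneg[OF that] by simp
  have int_Z: "integrable M (\<lambda>x. exp (- real n * \<phi> x))" for n
    using exp_le by (intro integrable_const_bound[where B = 1]) auto
  have int_g: "integrable M g"
    using bound by (intro integrable_const_bound[where B = B]) auto
  have int_N: "integrable M (\<lambda>x. exp (- real n * \<phi> x) * g x)" for n
    using bound mult_mono[OF exp_le bound] B0
    by (intro integrable_const_bound[where B = B]) (auto simp: abs_mult)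
  have "\<forall>\<^sub>F n in sequentially. dist (N n / Z n) l < \<epsilon>" if \<epsilon>: "\<epsilon> > 0" for \<epsilon>
  proof -
    obtain \<delta> where \<delta>: "\<delta> > 0" "\<And>x. x \<in> space M \<Longrightarrow> \<phi> x < \<delta> \<Longrightarrow> \<bar>g x - l\<bar> < \<epsilon> / 2"
      using lim[of "\<epsilon> / 2"] \<epsilon> by auto
    \<comment> \<open>Using \<delta> / 2 here against \<delta> for the far region is what leaves a
      decaying quotient.\<close>
    define q where "q = prob {x \<in> space M. \<phi> x < \<delta> / 2}"
    have q: "q > 0" unfolding q_def using \<delta> by (intro pos) simp
    \<comment> \<open>A bound for |g - l| on the whole space, used where \<phi> \<ge>
      \<delta>.\<close>
    define C where "C = B + \<bar>l\<bar>"
    have le: "\<bar>N n / Z n - l\<bar> \<le> \<epsilon> / 2 + C / q * exp (- (real n * (\<delta> / 2)))" for n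
    proof -
      have "exp (- (real n * (\<delta> / 2))) * q
          = expectation (\<lambda>x. exp (- (real n * (\<delta> / 2))) * indicator {x \<in> space M. \<phi> x < \<delta> / 2} x)"
        by (simp add: q_def)
      also have "\<dots> \<le> Z n"
        unfolding Z_def
      proof (intro integral_mono int_Z)
        fix x assume x: "x \<in> space M"
        have "real n * \<phi> x \<le> real n * (\<delta> / 2)" if "\<phi> x < \<delta> / 2"
          using that by (intro mult_left_mono) auto
        then show "exp (- (real n * (\<delta> / 2))) * indicator {x \<in> space M. \<phi> x < \<delta> / 2} x
            \<le> exp (- real n * \<phi> x)"
          by (auto split: split_indicator)
      qed (auto intro!: integrable_mult_right integrable_real_indicator simp: emeasure_eq_measure)
      finally have Zge: "exp (- (real n * (\<delta> / 2))) * q \<le> Z n" .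
      then have Zpos: "Z n > 0" using q by (smt (verit) exp_gt_zero mult_pos_pos)
      have "\<bar>N n - Z n * l\<bar> = \<bar>expectation (\<lambda>x. exp (- real n * \<phi> x) * g x - exp (- real n * \<phi> x) * l)\<bar>"
        unfolding N_def Z_def using int_Z int_N by simp
      also have "\<dots> \<le> expectation (\<lambda>x. \<bar>exp (- real n * \<phi> x) * g x - exp (- real n * \<phi> x) * l\<bar>)"
        by (rule integral_abs_bound)
      \<comment> \<open>The first summand dominates where \<phi> < \<delta>, the second elsewhere;
        taking their sum avoids splitting the integral.\<close>
      also have "\<dots> \<le> expectation (\<lambda>x. \<epsilon> / 2 * exp (- real n * \<phi> x) + C * exp (- (real n * \<delta>)))"
      proof (rule integral_mono)
        fix x assume x: "x \<in> space M"
        have *: "\<bar>exp (- real n * \<phi> x) * g x - exp (- real n * \<phi> x) * l\<bar>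
            = \<bar>g x - l\<bar> * exp (- real n * \<phi> x)"
          unfolding right_diff_distrib[symmetric] abs_mult by simp
        show "\<bar>exp (- real n * \<phi> x) * g x - exp (- real n * \<phi> x) * l\<bar>
            \<le> \<epsilon> / 2 * exp (- real n * \<phi> x) + C * exp (- (real n * \<delta>))"
        proof (cases "\<phi> x < \<delta>")
          case True
          have "\<bar>g x - l\<bar> * exp (- real n * \<phi> x) \<le> \<epsilon> / 2 * exp (- real n * \<phi> x)"
            using \<delta>(2)[OF x True] by (intro mult_right_mono) auto
          moreover have "0 \<le> C * exp (- (real n * \<delta>))" using B0 by (simp add: C_def)
          ultimately show ?thesis unfolding * by linarith
        next
          case False
          have "\<bar>g x - l\<bar> * exp (- real n * \<phi> x) \<le> C * exp (- (real n * \<delta>))"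
            using False bound[OF x] by (intro mult_mono) (auto simp: C_def mult_left_mono)
          moreover have "0 \<le> \<epsilon> / 2 * exp (- real n * \<phi> x)" using \<epsilon> by simp
          ultimately show ?thesis unfolding * by linarith
        qed
      qed (use int_Z int_N in auto)
      also have "\<dots> = \<epsilon> / 2 * Z n + C * exp (- (real n * \<delta>))"
        unfolding Z_def using int_Z by (simp add: prob_space)
      finally have "\<bar>N n - Z n * l\<bar> / Z n \<le> (\<epsilon> / 2 * Z n + C * exp (- (real n * \<delta>))) / Z n"
        using Zpos by (intro divide_right_mono) auto
      also have "\<dots> = \<epsilon> / 2 + C * exp (- (real n * \<delta>)) / Z n"
        using Zpos by (simp add: add_divide_distrib)
      also have "C * exp (- (real n * \<delta>)) / Z n
          \<le> C * exp (- (real n * \<delta>)) / (exp (- (real n * (\<delta> / 2))) * q)"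
        using Zge Zpos q B0 by (intro divide_left_mono) (auto simp: C_def)
      also have "\<dots> = C / q * exp (- (real n * (\<delta> / 2)))"
        using q by (simp add: exp_minus field_simps flip: exp_double) (simp flip: exp_double exp_add)
      also have "\<bar>N n - Z n * l\<bar> / Z n = \<bar>N n / Z n - l\<bar>"
      proof -
        have "N n / Z n - l = (N n - Z n * l) / Z n"
          using Zpos by (simp add: diff_divide_distrib)
        then show ?thesis using Zpos by simp
      qed
      finally show ?thesis by simp
    qed
    have "(\<lambda>n. exp (- (\<delta> / 2)) ^ n) \<longlonglongrightarrow> 0"
      using \<delta> by (intro LIMSEQ_power_zero) simp
    then have "(\<lambda>n. \<epsilon> / 2 + C / q * exp (- (real n * (\<delta> / 2)))) \<longlonglongrightarrow> \<epsilon> / 2 + C / q * 0"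
      by (intro tendsto_intros) (simp flip: exp_of_nat_mult)
    then have "\<forall>\<^sub>F n in sequentially. \<epsilon> / 2 + C / q * exp (- (real n * (\<delta> / 2))) < \<epsilon>"
      by (rule order_tendstoD(2)) (use \<epsilon> in simp)
    then show ?thesis
      using le by (auto simp: dist_real_def elim!: eventually_mono intro: le_less_trans)
  qed
  then show ?thesis unfolding N_def Z_def by (rule tendstoI)
qed

section \<open>Finitely supported approximation\<close>

text \<open>Round all functions in \<open>F\<close> down to multiples of \<epsilon> simultaneously.
  Boundedness leaves finitely many patterns, which cut the space into measurable cells on which each
  function varies by at most \<epsilon>. One point per cell, weighted by the probability of the
  cell, is the sample.\<close>

lemma (in prob_space) finite_sample_approximates_expectations:
  fixes F :: "('a \<Rightarrow> real) set"
  assumes F: "finite F" and \<epsilon>: "\<epsilon> > 0"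
    and meas: "\<And>f. f \<in> F \<Longrightarrow> f \<in> borel_measurable M"
    and bound: "\<And>f. f \<in> F \<Longrightarrow> bounded (f ` space M)"
  obtains n :: nat and w x where "n \<ge> 1" "\<And>i. i < n \<Longrightarrow> w i \<ge> 0" "(\<Sum>i<n. w i) = 1"
    "\<And>i. i < n \<Longrightarrow> x i \<in> space M"
    "\<And>f. f \<in> F \<Longrightarrow> \<bar>(\<Sum>i<n. w i * f (x i)) - expectation f\<bar> \<le> \<epsilon>"
proof -
  \<comment> \<open>Restriction to \<open>F\<close> makes the codes extensional: they lie in a
    finite product, and two of them are equal as soon as they agree on \<open>F\<close>.\<close>
  define code where "code x = (\<lambda>f\<in>F. \<lfloor>f x / \<epsilon>\<rfloor>)" for x
  define I where "I = code ` space M"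
  define A where "A c = {x \<in> space M. code x = c}" for c
  \<comment> \<open>The choice is meaningful only for codes in \<open>I\<close>, whose cells are
    nonempty.\<close>
  define pt where "pt c = (SOME x. x \<in> A c)" for c
  have fin_floor: "finite ((\<lambda>x. \<lfloor>f x / \<epsilon>\<rfloor>) ` space M)" if "f \<in> F" for f
  proof -
    obtain B where B: "\<And>x. x \<in> space M \<Longrightarrow> \<bar>f x\<bar> \<le> B"
      using bound[OF \<open>f \<in> F\<close>] by (auto simp: bounded_iff)
    have "(\<lambda>x. \<lfloor>f x / \<epsilon>\<rfloor>) ` space M \<subseteq> {\<lfloor>- B / \<epsilon>\<rfloor> .. \<lfloor>B / \<epsilon>\<rfloor>}"
    proof
      fix k assume "k \<in> (\<lambda>x. \<lfloor>f x / \<epsilon>\<rfloor>) ` space M"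
      then obtain x where "x \<in> space M" "k = \<lfloor>f x / \<epsilon>\<rfloor>" by blast
      moreover from this have "- B / \<epsilon> \<le> f x / \<epsilon>" "f x / \<epsilon> \<le> B / \<epsilon>"
        using B[of x] \<epsilon> by (intro divide_right_mono; simp add: abs_le_iff)+
      ultimately show "k \<in> {\<lfloor>- B / \<epsilon>\<rfloor> .. \<lfloor>B / \<epsilon>\<rfloor>}"
        by (simp only: atLeastAtMost_iff floor_mono)
    qed
    then show ?thesis by (rule finite_subset) simp
  qed
  have "I \<subseteq> (\<Pi>\<^sub>E f\<in>F. (\<lambda>x. \<lfloor>f x / \<epsilon>\<rfloor>) ` space M)"
    by (auto simp: I_def code_def)
  then have finI: "finite I"
    by (rule finite_subset) (rule finite_PiE[OF F fin_floor])
  have A_meas: "A c \<in> sets M" if "c \<in> I" for c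
  proof -
    have "c \<in> extensional F" using that by (auto simp: I_def code_def)
    then have "A c = {x \<in> space M. \<forall>f\<in>F. \<lfloor>f x / \<epsilon>\<rfloor> = c f}"
      by (auto simp: A_def code_def fun_eq_iff extensional_def)
    also have "\<dots> \<in> sets M"
    proof (rule sets.sets_Collect_finite_All[OF _ F])
      fix f assume "f \<in> F"
      then have [measurable]: "f \<in> borel_measurable M" by (rule meas)
      show "{x \<in> space M. \<lfloor>f x / \<epsilon>\<rfloor> = c f} \<in> sets M" by measurable
    qed
    finally show ?thesis .
  qed
  have pt: "pt c \<in> A c" if "c \<in> I" for c
  proof -
    have "\<exists>x. x \<in> A c" using that by (auto simp: A_def I_def)
    then show ?thesis unfolding pt_def by (rule someI_ex)
  qed
  \<comment> \<open>A point lies in exactly one cell, that of its own code, so every function of the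
    code is a finite combination of indicators of cells.\<close>
  have sum_ind: "(\<Sum>c\<in>I. indicator (A c) x * h c) = h (code x)" if "x \<in> space M" for x and h :: "_ \<Rightarrow> real"
  proof -
    have "(\<Sum>c\<in>I. indicator (A c) x * h c) = (\<Sum>c\<in>I. if c = code x then h c else 0)"
      using that by (intro sum.cong) (auto simp: A_def)
    then show ?thesis using that finI by (simp add: I_def)
  qed
  have expect: "expectation (\<lambda>x. h (code x)) = (\<Sum>c\<in>I. prob (A c) * h c)"
    "integrable M (\<lambda>x. h (code x))" for h :: "_ \<Rightarrow> real"
  proof -
    have int: "integrable M (\<lambda>x. indicator (A c) x * h c)" if "c \<in> I" for c
      using A_meas[OF that]
      by (intro integrable_mult_left integrable_real_indicator) (auto simp: emeasure_eq_measure)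
    then have "integrable M (\<lambda>x. \<Sum>c\<in>I. indicator (A c) x * h c)" by (rule Bochner_Integration.integrable_sum)
    moreover have "integrable M (\<lambda>x. \<Sum>c\<in>I. indicator (A c) x * h c) = integrable M (\<lambda>x. h (code x))"
      by (rule Bochner_Integration.integrable_cong[OF refl sum_ind])
    ultimately show "integrable M (\<lambda>x. h (code x))" by simp
    have "expectation (\<lambda>x. h (code x)) = expectation (\<lambda>x. \<Sum>c\<in>I. indicator (A c) x * h c)"
      by (rule Bochner_Integration.integral_cong[OF refl sum_ind[symmetric]])
    also have "\<dots> = (\<Sum>c\<in>I. expectation (\<lambda>x. indicator (A c) x * h c))"
      using int by (rule Bochner_Integration.integral_sum)
    also have "\<dots> = (\<Sum>c\<in>I. prob (A c) * h c)"
      using A_meas by (intro sum.cong) (auto simp: emeasure_eq_measure)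
    finally show "expectation (\<lambda>x. h (code x)) = (\<Sum>c\<in>I. prob (A c) * h c)" .
  qed
  obtain e where e: "bij_betw e {..<card I} I"
    using ex_bij_betw_nat_finite[OF finI] by (auto simp: atLeast0LessThan)
  have eI: "e i \<in> I" if "i < card I" for i
    using e that by (auto simp: bij_betw_def)
  have reindex: "(\<Sum>i<card I. h (e i)) = (\<Sum>c\<in>I. h c)" for h :: "_ \<Rightarrow> real"
    by (rule sum.reindex_bij_betw[OF e])
  show thesis
  proof (rule that[of "card I" "\<lambda>i. prob (A (e i))" "\<lambda>i. pt (e i)"])
    show "card I \<ge> 1"
      using finI not_empty by (simp add: I_def Suc_le_eq card_gt_0_iff)
    show "(\<Sum>i<card I. prob (A (e i))) = 1"
      using reindex[of "\<lambda>c. prob (A c)"] expect(1)[of "\<lambda>_. 1"] by (simp add: prob_space)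
    show "pt (e i) \<in> space M" if "i < card I" for i
      using pt[OF eI[OF that]] by (simp add: A_def)
    fix f assume f: "f \<in> F"
    have near: "\<bar>f (pt (code x)) - f x\<bar> \<le> \<epsilon>" if x: "x \<in> space M" for x
    proof -
      have "code (pt (code x)) = code x"
        using pt[of "code x"] x by (auto simp: A_def I_def)
      then have "\<lfloor>f (pt (code x)) / \<epsilon>\<rfloor> = \<lfloor>f x / \<epsilon>\<rfloor>"
        using f by (auto simp: code_def fun_eq_iff restrict_def split: if_splits)
      then have "\<bar>f (pt (code x)) / \<epsilon> - f x / \<epsilon>\<bar> \<le> 1" by linarith
      then show ?thesis using \<epsilon> by (simp add: field_simps flip: diff_divide_distrib)
    qed
    obtain B where "\<And>x. x \<in> space M \<Longrightarrow> \<bar>f x\<bar> \<le> B"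
      using bound[OF f] by (auto simp: bounded_iff)
    then have intf: "integrable M f"
      using meas[OF f] by (intro integrable_const_bound[where B = B]) auto
    \<comment> \<open>The weighted sum is exactly the expectation of \<open>f\<close> at the
      representative of the cell of x, so the error is the integral of a pointwise error of at most
      \<epsilon>.\<close>
    have "(\<Sum>i<card I. prob (A (e i)) * f (pt (e i))) - expectation f
        = expectation (\<lambda>x. f (pt (code x)) - f x)"
      unfolding reindex[of "\<lambda>c. prob (A c) * f (pt c)"] expect(1)[of "\<lambda>c. f (pt c)", symmetric]
      by (rule Bochner_Integration.integral_diff[symmetric, OF expect(2) intf])
    also have "\<bar>\<dots>\<bar> \<le> expectation (\<lambda>x. \<bar>f (pt (code x)) - f x\<bar>)"
      by (rule integral_abs_bound)
    also have "\<dots> \<le> expectation (\<lambda>_. \<epsilon>)"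
      using near expect(2)[of "\<lambda>c. f (pt c)"] intf by (intro integral_mono) auto
    finally show "\<bar>(\<Sum>i<card I. prob (A (e i)) * f (pt (e i))) - expectation f\<bar> \<le> \<epsilon>"
      by (simp add: prob_space)
  qed simp
qed

section \<open>Basic neighbourhoods in the weak topology\<close>

text \<open>Induction on the generation of the topology: an intersection takes the union of the test
  families and the smaller tolerance, a union inherits from a member containing \<open>M\<close>,
  and a subbasic set needs one test function and an interval inside \<open>U\<close>.\<close>

lemma open_weak_topology_nhd:
  assumes "openin (weak_topology X) T" "M \<in> T"
  obtains F :: "('a::topological_space \<Rightarrow> real) set" and \<epsilon> where "finite F" "\<epsilon> > 0"
    "\<And>f. f \<in> F \<Longrightarrow> continuous_on X f" "\<And>f. f \<in> F \<Longrightarrow> bounded (f ` X)"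
    "\<And>N. N \<in> borel_probs X \<Longrightarrow> (\<forall>f\<in>F. \<bar>(LINT x|N. f x) - (LINT x|M. f x)\<bar> < \<epsilon>) \<Longrightarrow> N \<in> T"
proof -
  define nhd where "nhd T F \<epsilon> \<longleftrightarrow> finite F \<and> \<epsilon> > 0 \<and>
      (\<forall>f\<in>F. continuous_on X f \<and> bounded (f ` X)) \<and>
      (\<forall>N\<in>borel_probs X. (\<forall>f\<in>F. \<bar>(LINT x|N. f x) - (LINT x|M. f x)\<bar> < \<epsilon>) \<longrightarrow> N \<in> T)"
    for T :: "'a measure set" and F and \<epsilon> :: real
  \<comment> \<open>Membership of \<open>M\<close> is a premise inside the induction formula, since
    the sets met during the generation need not contain \<open>M\<close>.\<close>
  have "M \<in> T \<longrightarrow> (\<exists>F \<epsilon>. nhd T F \<epsilon>)"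
    using assms(1) unfolding weak_topology_def openin_topology_generated_by_iff
  proof (induction rule: generate_topology_on.induct)
    case Empty
    then show ?case by simp
  next
    case (Int a b)
    show ?case
    proof
      assume "M \<in> a \<inter> b"
      with Int.IH obtain F \<epsilon> G \<delta> where "nhd a F \<epsilon>" "nhd b G \<delta>" by blast
      then have "nhd (a \<inter> b) (F \<union> G) (min \<epsilon> \<delta>)"
        unfolding nhd_def ball_Un by simp
      then show "\<exists>F \<epsilon>. nhd (a \<inter> b) F \<epsilon>" by blast
    qed
  next
    case (UN K)
    show ?case
    proof
      assume "M \<in> \<Union>K"
      then obtain a F \<epsilon> where "a \<in> K" "nhd a F \<epsilon>" using UN.IH by blast
      then have "nhd (\<Union>K) F \<epsilon>" unfolding nhd_def by simp blast
      then show "\<exists>F \<epsilon>. nhd (\<Union>K) F \<epsilon>" by blast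
    qed
  next
    case (Basis s)
    then obtain f :: "'a \<Rightarrow> real" and U where s: "s = {M \<in> borel_probs X. (LINT x|M. f x) \<in> U}"
      and f: "continuous_on X f" "bounded (f ` X)" and U: "open U"
      by blast
    show ?case
    proof
      assume "M \<in> s"
      then obtain \<epsilon> where "\<epsilon> > 0" "\<And>y. \<bar>y - (LINT x|M. f x)\<bar> < \<epsilon> \<Longrightarrow> y \<in> U"
        using U unfolding s open_dist by (auto simp: dist_real_def)
      then have "\<forall>N\<in>borel_probs X. (\<forall>f\<in>{f}. \<bar>(LINT x|N. f x) - (LINT x|M. f x)\<bar> < \<epsilon>) \<longrightarrow> N \<in> s"
        unfolding s by simp
      then have "nhd s {f} \<epsilon>" unfolding nhd_def using f \<open>\<epsilon> > 0\<close> by simp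
      then show "\<exists>F \<epsilon>. nhd s F \<epsilon>" by blast
    qed
  qed
  with assms(2) obtain F \<epsilon> where "nhd T F \<epsilon>" by blast
  then show thesis unfolding nhd_def by (intro that[of F \<epsilon>]) simp_all
qed

subsection \<open>Hyperboloid distributions and their mixtures\<close>

lemma minkowski_inner: "minkowski x y = fst x * fst y - snd x \<bullet> snd y"
  by (simp add: minkowski_def inner_vec_def)

lemma hyp_lift_inner: "hyp_lift x = (sqrt (1 + x \<bullet> x), x)"
  by (simp add: hyp_lift_def inner_vec_def power2_eq_square)

lemma hyp_lift_in_hyperboloid: "hyp_lift x \<in> hyperboloid"
  by (simp add: hyp_lift_def hyperboloid_def)

lemma hyp_lift_snd:
  assumes "m \<in> hyperboloid"
  shows "hyp_lift (snd m) = m"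
  using assms by (simp add: hyp_lift_def hyperboloid_def prod_eq_iff)

text \<open>These are, in order, the hypotheses of \<open>nn_integral_hyperboloid_Laplace\<close>
  with \<open>a = fst \<theta>\<close>, \<open>b = snd \<theta>\<close> and
  \<open>t = minkowski_norm \<theta>\<close>.\<close>

lemma hyp_param_space_minkowski_norm:
  assumes "\<theta> \<in> hyp_param_space"
  shows "fst \<theta> > 0" "minkowski_norm \<theta> > 0"
    "(minkowski_norm \<theta>)\<^sup>2 = (fst \<theta>)\<^sup>2 - snd \<theta> \<bullet> snd \<theta>"
proof -
  have gt: "sqrt (snd \<theta> \<bullet> snd \<theta>) < fst \<theta>"
    using assms by (simp add: hyp_param_space_def inner_vec_def power2_eq_square)
  then show pos: "fst \<theta> > 0" by (smt (verit) inner_ge_zero real_sqrt_ge_zero)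
  have "(sqrt (snd \<theta> \<bullet> snd \<theta>))\<^sup>2 < (fst \<theta>)\<^sup>2"
    using gt by (intro power_strict_mono) auto
  then have "minkowski \<theta> \<theta> > 0" "minkowski \<theta> \<theta> = (fst \<theta>)\<^sup>2 - snd \<theta> \<bullet> snd \<theta>"
    by (simp_all add: minkowski_inner power2_eq_square)
  then show "minkowski_norm \<theta> > 0" "(minkowski_norm \<theta>)\<^sup>2 = (fst \<theta>)\<^sup>2 - snd \<theta> \<bullet> snd \<theta>"
    by (simp_all add: minkowski_norm_def)
qed

lemma hyp_density_inner:
  fixes \<theta> :: "real \<times> (real ^ 'n)"
  shows "hyp_density \<theta> x = hyp_const CARD('n) (minkowski_norm \<theta>) *
     (exp (- (fst \<theta> * sqrt (1 + x \<bullet> x) - snd \<theta> \<bullet> x)) / sqrt (1 + x \<bullet> x))"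
  by (simp add: hyp_density_def minkowski_inner hyp_lift_inner inner_vec_def power2_eq_square)

lemma borel_measurable_hyp_density [measurable]: "hyp_density \<theta> \<in> borel_measurable borel"
  unfolding hyp_density_inner by measurable

lemma hyp_density_pos:
  assumes "\<theta> \<in> hyp_param_space"
  shows "hyp_density \<theta> x > 0"
proof -
  have "1 + x \<bullet> x > 0" by (simp add: add_pos_nonneg)
  then show ?thesis
    unfolding hyp_density_inner hyp_const_def
    using hyp_param_space_minkowski_norm(2)[OF assms] nn_integral_bessel_K(2) by simp
qed

text \<open>\<open>hyp_const\<close> at the Minkowski norm is the reciprocal of the Laplace
  integral; positivity of \<open>bessel_K\<close> makes the two cancel.\<close>

lemma nn_integral_hyp_density:
  fixes \<theta> :: "real \<times> (real ^ 'n)"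
  assumes "\<theta> \<in> hyp_param_space"
  shows "(\<integral>\<^sup>+x. ennreal (hyp_density \<theta> x) \<partial>lborel) = 1"
proof -
  define t where "t = minkowski_norm \<theta>"
  define \<nu> where "\<nu> = (real CARD('n) - 1) / 2"
  have t: "t > 0" using hyp_param_space_minkowski_norm(2)[OF assms] by (simp add: t_def)
  have K: "bessel_K \<nu> t > 0" by (rule nn_integral_bessel_K(2)[OF t])
  have "(\<integral>\<^sup>+x. ennreal (hyp_density \<theta> x) \<partial>lborel) = ennreal (hyp_const CARD('n) t) *
      (\<integral>\<^sup>+x. ennreal (exp (- (fst \<theta> * sqrt (1 + x \<bullet> x) - snd \<theta> \<bullet> x)) / sqrt (1 + x \<bullet> x)) \<partial>lborel)"
    unfolding hyp_density_inner t_def[symmetric]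
    by (subst ennreal_mult'') (auto intro!: nn_integral_cmult)
  also have "\<dots> = ennreal (hyp_const CARD('n) t) *
      ennreal (2 * (2 * pi) powr \<nu> * bessel_K \<nu> t / t powr \<nu>)"
    using nn_integral_hyperboloid_Laplace[OF hyp_param_space_minkowski_norm[OF assms]]
    by (simp add: t_def \<nu>_def)
  also have "\<dots> = 1"
    using t K by (simp add: hyp_const_def flip: \<nu>_def ennreal_mult'')
  finally show ?thesis .
qed

lemma emeasure_hyp_dist:
  assumes A [measurable]: "A \<in> sets (restrict_space borel hyperboloid)"
  shows "emeasure (hyp_dist \<theta>) A = (\<integral>\<^sup>+x. ennreal (hyp_density \<theta> x) * indicator (hyp_lift -` A) x \<partial>lborel)"
proof -
  have "hyp_lift -` A \<in> sets borel" using measurable_sets[OF measurable_hyp_lift A] by simp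
  then show ?thesis
    unfolding hyp_dist_def by (subst emeasure_distr) (simp_all add: emeasure_density)
qed

lemma integrable_hyp_density:
  assumes "\<theta> \<in> hyp_param_space" and [measurable]: "f \<in> borel_measurable borel"
    and "\<And>x. \<bar>f x\<bar> \<le> (B :: real)"
  shows "integrable lborel (\<lambda>x. f x * hyp_density \<theta> x)"
proof (rule Bochner_Integration.integrable_bound)
  show "integrable lborel (\<lambda>x. B * hyp_density \<theta> x)"
    using nn_integral_hyp_density[OF assms(1)] hyp_density_pos[OF assms(1)]
    by (intro integrable_mult_right integrableI_nonneg) (auto intro: less_imp_le)
  show "AE x in lborel. norm (f x * hyp_density \<theta> x) \<le> norm (B * hyp_density \<theta> x)"
    using assms(3) by (auto simp: abs_mult intro!: mult_right_mono order_trans[OF assms(3)])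
qed measurable

section \<open>Integration against mixtures\<close>

text \<open>The mixture is given as a set function. As the image of a single Lebesgue density it
  becomes accessible to the integral rules for \<open>distr\<close> and
  \<open>density\<close>.\<close>

lemma hyp_mixture_eq_distr:
  assumes \<theta>: "\<And>i. i < n \<Longrightarrow> \<theta> i \<in> hyp_param_space" and w: "\<And>i. i < n \<Longrightarrow> w i \<ge> 0"
  shows "hyp_mixture n w \<theta> = distr (density lborel (\<lambda>x. ennreal (\<Sum>i<n. w i * hyp_density (\<theta> i) x)))
           (restrict_space borel hyperboloid) hyp_lift" (is "_ = ?D")
proof (rule measure_eqI)
  fix A assume "A \<in> sets (hyp_mixture n w \<theta>)"
  then have A [measurable]: "A \<in> sets (restrict_space borel hyperboloid)" by simp
  let ?L = "hyp_lift -` A"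
  have L [measurable]: "?L \<in> sets borel" using measurable_sets[OF measurable_hyp_lift A] by simp
  have "emeasure (hyp_mixture n w \<theta>) A = (\<Sum>i<n. ennreal (w i) * emeasure (hyp_dist (\<theta> i)) A)"
    by (rule emeasure_hyp_mixture[OF A])
  also have "\<dots> = (\<Sum>i<n. \<integral>\<^sup>+x. ennreal (w i) * (ennreal (hyp_density (\<theta> i) x) * indicator ?L x) \<partial>lborel)"
    by (subst nn_integral_cmult) (measurable, simp add: emeasure_hyp_dist[OF A])
  also have "\<dots> = (\<integral>\<^sup>+x. (\<Sum>i<n. ennreal (w i) * (ennreal (hyp_density (\<theta> i) x) * indicator ?L x)) \<partial>lborel)"
    by (rule nn_integral_sum[symmetric]) measurable
  also have "\<dots> = (\<integral>\<^sup>+x. ennreal (\<Sum>i<n. w i * hyp_density (\<theta> i) x) * indicator ?L x \<partial>lborel)"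
  proof (intro nn_integral_cong)
    fix x
    have "ennreal (\<Sum>i<n. w i * hyp_density (\<theta> i) x) = (\<Sum>i<n. ennreal (w i) * ennreal (hyp_density (\<theta> i) x))"
      using w hyp_density_pos[OF \<theta>]
      by (subst sum_ennreal[symmetric]) (auto simp: ennreal_mult' less_imp_le)
    then show "(\<Sum>i<n. ennreal (w i) * (ennreal (hyp_density (\<theta> i) x) * indicator ?L x))
        = ennreal (\<Sum>i<n. w i * hyp_density (\<theta> i) x) * indicator ?L x"
      by (simp add: sum_distrib_right mult.assoc)
  qed
  also have "\<dots> = emeasure ?D A"
    by (subst emeasure_distr) (simp_all add: emeasure_density)
  finally show "emeasure (hyp_mixture n w \<theta>) A = emeasure ?D A" .
qed simp

lemma prob_space_hyp_mixture:
  fixes \<theta> :: "nat \<Rightarrow> real \<times> (real ^ 'n)"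
  assumes \<theta>: "\<And>i. i < n \<Longrightarrow> \<theta> i \<in> hyp_param_space" and w: "\<And>i. i < n \<Longrightarrow> w i \<ge> 0" "(\<Sum>i<n. w i) = 1"
  shows "prob_space (hyp_mixture n w \<theta>)"
proof
  let ?X = "hyperboloid :: (real \<times> (real ^ 'n)) set"
  have sp: "space (hyp_mixture n w \<theta>) = ?X"
    using sets_eq_imp_space_eq[OF sets_hyp_mixture] by (simp add: space_restrict_space)
  have X: "?X \<in> sets (restrict_space borel ?X)"
    using sets.top[of "restrict_space borel ?X"] by (simp add: space_restrict_space)
  have L: "hyp_lift -` ?X = UNIV" using hyp_lift_in_hyperboloid by auto
  have "emeasure (hyp_dist (\<theta> i)) ?X = 1" if "i < n" for i
    using nn_integral_hyp_density[OF \<theta>[OF that]] unfolding emeasure_hyp_dist[OF X] L by simp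
  then have "emeasure (hyp_mixture n w \<theta>) ?X = (\<Sum>i<n. ennreal (w i))"
    unfolding emeasure_hyp_mixture[OF X] by (intro sum.cong) auto
  then show "emeasure (hyp_mixture n w \<theta>) (space (hyp_mixture n w \<theta>)) = 1"
    using w sum_ennreal[of "{..<n}" w] by (simp add: sp)
qed

text \<open>Reduces a mixture integral to finitely many Lebesgue integrals, so that limits can be
  taken in each component separately. The bound on \<open>f\<close> makes every summand
  integrable.\<close>

lemma integral_hyp_mixture:
  fixes f :: "real \<times> (real ^ 'n) \<Rightarrow> real"
  assumes \<theta>: "\<And>i. i < n \<Longrightarrow> \<theta> i \<in> hyp_param_space" and w: "\<And>i. i < n \<Longrightarrow> w i \<ge> 0"
    and f [measurable]: "f \<in> borel_measurable (restrict_space borel hyperboloid)"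
    and bound: "\<And>x. x \<in> hyperboloid \<Longrightarrow> \<bar>f x\<bar> \<le> B"
  shows "(LINT x|hyp_mixture n w \<theta>. f x)
           = (\<Sum>i<n. w i * (LINT x|lborel. f (hyp_lift x) * hyp_density (\<theta> i) x))"
proof -
  have [measurable]: "(\<lambda>x. f (hyp_lift x)) \<in> borel_measurable borel" by measurable
  have nonneg: "0 \<le> (\<Sum>i<n. w i * hyp_density (\<theta> i) x)" for x
    using w hyp_density_pos[OF \<theta>]
    by (intro sum_nonneg mult_nonneg_nonneg) (auto intro: less_imp_le)
  have "(LINT x|hyp_mixture n w \<theta>. f x)
      = (LINT x|density lborel (\<lambda>x. ennreal (\<Sum>i<n. w i * hyp_density (\<theta> i) x)). f (hyp_lift x))"
    by (subst hyp_mixture_eq_distr[OF \<theta> w], assumption+, rule integral_distr) measurable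
  also have "\<dots> = (LINT x|lborel. (\<Sum>i<n. w i * hyp_density (\<theta> i) x) * f (hyp_lift x))"
    using nonneg by (subst integral_density) auto
  also have "\<dots> = (LINT x|lborel. (\<Sum>i<n. w i * (f (hyp_lift x) * hyp_density (\<theta> i) x)))"
    by (simp add: sum_distrib_left sum_distrib_right mult_ac)
  also have "\<dots> = (\<Sum>i<n. LINT x|lborel. w i * (f (hyp_lift x) * hyp_density (\<theta> i) x))"
    using bound[OF hyp_lift_in_hyperboloid]
    by (intro Bochner_Integration.integral_sum integrable_mult_right
        integrable_hyp_density[OF \<theta>, where B = B]) auto
  finally show ?thesis by simp
qed

subsection \<open>Concentration\<close>

text \<open>The left side is A - B, where A is the product of the two square roots and B = 1 + a
  \<bullet> x. By Cauchy-Schwarz A^2 - B^2 is at least |x - a|^2, and its factor A + B is at most 2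
  A.\<close>

lemma minkowski_hyp_lift_ge:
  "minkowski (hyp_lift a) (hyp_lift x) - 1
     \<ge> (norm (x - a))\<^sup>2 / (2 * (sqrt (1 + a \<bullet> a) * sqrt (1 + x \<bullet> x)))"
proof -
  define A where "A = sqrt (1 + a \<bullet> a) * sqrt (1 + x \<bullet> x)"
  define B where "B = 1 + a \<bullet> x"
  have A2: "A\<^sup>2 = (1 + a \<bullet> a) * (1 + x \<bullet> x)" by (simp add: A_def power_mult_distrib)
  have "A\<^sup>2 - B\<^sup>2 = (norm (x - a))\<^sup>2 + ((a \<bullet> a) * (x \<bullet> x) - (a \<bullet> x)\<^sup>2)"
    unfolding A2 B_def power2_norm_eq_inner
    by (simp add: algebra_simps power2_eq_square inner_diff_left inner_diff_right inner_commute)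
  then have ge: "(norm (x - a))\<^sup>2 \<le> A\<^sup>2 - B\<^sup>2"
    using Cauchy_Schwarz_ineq[of a x] by simp
  have A: "A > 0" unfolding A_def by (simp add: add_pos_nonneg)
  have BA: "\<bar>B\<bar> \<le> A"
  proof -
    have "0 \<le> A\<^sup>2 - B\<^sup>2" using ge zero_le_power2 order_trans by blast
    then show ?thesis using A abs_le_square_iff[of B A] by simp
  qed
  have "(norm (x - a))\<^sup>2 \<le> (A - B) * (A + B)"
    using ge by (simp add: power2_eq_square algebra_simps)
  also have "\<dots> \<le> (A - B) * (2 * A)" using BA by (intro mult_left_mono) auto
  finally have "(norm (x - a))\<^sup>2 / (2 * A) \<le> A - B" using A by (simp add: divide_le_eq)
  then show ?thesis by (simp add: A_def B_def minkowski_inner hyp_lift_inner)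
qed

text \<open>With r = |x - a| the square root of 1 + x \<bullet> x is at most C + r, so the previous
  bound is at least a constant times r^2 / (C + r). This increases with r, hence its value at r =
  \<epsilon> serves as \<delta>, for remote points too.\<close>

lemma minkowski_hyp_lift_separates:
  assumes "\<epsilon> > 0"
  shows "\<exists>\<delta>>0. \<forall>x. minkowski (hyp_lift a) (hyp_lift x) - 1 < \<delta> \<longrightarrow> dist x a < \<epsilon>"
proof -
  define m where "m = sqrt (1 + a \<bullet> a)"
  define C where "C = 1 + norm a"
  have pos: "m > 0" "C > 0" by (auto simp: m_def C_def add_pos_nonneg)
  have "\<epsilon>\<^sup>2 / (2 * (m * (C + \<epsilon>))) \<le> minkowski (hyp_lift a) (hyp_lift x) - 1"
    if "dist x a \<ge> \<epsilon>" for x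
  proof -
    define r where "r = norm (x - a)"
    have r: "r \<ge> \<epsilon>" using that by (simp add: r_def dist_norm)
    have "sqrt (1 + x \<bullet> x) \<le> sqrt 1 + sqrt (x \<bullet> x)" by (rule sqrt_add_le_add_sqrt) auto
    also have "\<dots> \<le> C + r"
      using norm_triangle_sub[of x a] by (simp add: C_def r_def norm_eq_sqrt_inner[symmetric])
    finally have x0: "sqrt (1 + x \<bullet> x) \<le> C + r" .
    have "\<epsilon>\<^sup>2 * (C + r) \<le> r\<^sup>2 * (C + \<epsilon>)"
    proof -
      have "\<epsilon>\<^sup>2 * C \<le> r\<^sup>2 * C" "(\<epsilon> * r) * \<epsilon> \<le> (\<epsilon> * r) * r"
        using r assms pos by (auto intro!: mult_right_mono mult_left_mono power_mono)
      then show ?thesis by (simp add: algebra_simps power2_eq_square)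
    qed
    then have "\<epsilon>\<^sup>2 / (C + \<epsilon>) \<le> r\<^sup>2 / (C + r)"
      using r assms pos by (simp add: divide_simps mult_ac)
    from divide_right_mono[OF this, of "2 * m"]
    have "\<epsilon>\<^sup>2 / (2 * (m * (C + \<epsilon>))) \<le> r\<^sup>2 / (2 * (m * (C + r)))"
      using pos by (simp add: mult_ac)
    also have "\<dots> \<le> r\<^sup>2 / (2 * (m * sqrt (1 + x \<bullet> x)))"
      using x0 pos r assms by (intro divide_left_mono) (auto simp: add_pos_nonneg)
    also have "\<dots> \<le> minkowski (hyp_lift a) (hyp_lift x) - 1"
      unfolding r_def m_def by (rule minkowski_hyp_lift_ge)
    finally show ?thesis .
  qed
  moreover have "\<epsilon>\<^sup>2 / (2 * (m * (C + \<epsilon>))) > 0" using assms pos by simp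
  ultimately show ?thesis by (metis not_le)
qed

lemma minkowski_hyp_lift_ge_1: "minkowski (hyp_lift a) (hyp_lift x) \<ge> 1"
proof -
  have "0 \<le> (norm (x - a))\<^sup>2 / (2 * (sqrt (1 + a \<bullet> a) * sqrt (1 + x \<bullet> x)))" by simp
  then show ?thesis using minkowski_hyp_lift_ge[of x a] by linarith
qed

lemma minkowski_hyp_lift_self: "minkowski (hyp_lift a) (hyp_lift a) = 1"
  by (simp add: minkowski_inner hyp_lift_inner)

lemma minkowski_scaleR_left: "minkowski (c *\<^sub>R x) y = c * minkowski x y"
  by (simp add: minkowski_inner algebra_simps)

lemma continuous_on_minkowski_hyp_lift: "continuous_on S (\<lambda>x. minkowski y (hyp_lift x))"
  unfolding minkowski_inner hyp_lift_inner by (intro continuous_intros)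

lemma scaled_hyp_lift_in_hyp_param_space:
  assumes "c > 0"
  shows "c *\<^sub>R hyp_lift a \<in> hyp_param_space" "minkowski_norm (c *\<^sub>R hyp_lift a) = c"
proof -
  have "(\<Sum>i\<in>UNIV. (c * a $ i)\<^sup>2) = c\<^sup>2 * (a \<bullet> a)"
    by (simp add: inner_vec_def power2_eq_square sum_distrib_left mult_ac)
  then have "sqrt (\<Sum>i\<in>UNIV. (c * a $ i)\<^sup>2) = c * sqrt (a \<bullet> a)"
    using assms by (simp add: real_sqrt_mult)
  then show "c *\<^sub>R hyp_lift a \<in> hyp_param_space"
    using assms by (simp add: hyp_param_space_def hyp_lift_inner)
  have "minkowski (c *\<^sub>R hyp_lift a) (c *\<^sub>R hyp_lift a) = c\<^sup>2"
    by (simp add: minkowski_inner hyp_lift_inner power2_eq_square algebra_simps)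
  then show "minkowski_norm (c *\<^sub>R hyp_lift a) = c"
    using assms by (simp add: minkowski_norm_def)
qed

lemma emeasure_lborel_open_pos:
  assumes "open S" "a \<in> (S :: 'a::euclidean_space set)"
  shows "emeasure lborel S > 0"
proof -
  obtain e where e: "e > 0" "ball a e \<subseteq> S" using assms openE by blast
  have "0 < emeasure lborel (ball a e)"
    using content_ball_pos[OF e(1), of a] emeasure_lborel_ball_finite[of a e]
    by (simp add: emeasure_eq_ennreal_measure top.not_eq_extremum)
  also have "\<dots> \<le> emeasure lborel S"
    using e assms by (intro emeasure_mono) auto
  finally show ?thesis .
qed

text \<open>As \<open>n\<close> grows, \<open>P\<^sub>\<theta>\<close> with \<open>\<theta> = (n + 1) m\<close> is the exponential tilt of \<open>P\<^sub>m\<close> by the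
  function \<open>n ([m, x] - 1)\<close>, which vanishes only at \<open>x = m\<close>.\<close>

lemma hyp_density_scaled_tendsto:
  fixes g :: "real ^ 'n \<Rightarrow> real"
  assumes g: "continuous_on UNIV g" and bound: "\<And>x. \<bar>g x\<bar> \<le> B"
  shows "(\<lambda>n. LINT x|lborel. g x * hyp_density ((1 + real n) *\<^sub>R hyp_lift a) x) \<longlonglongrightarrow> g a"
proof -
  define \<phi> where "\<phi> x = minkowski (hyp_lift a) (hyp_lift x) - 1" for x
  define M where "M = density lborel (\<lambda>x. ennreal (hyp_density (hyp_lift a) x))"
  \<comment> \<open>The scale 1 + n is positive for every n, and n = 0 gives the base distribution
    of the tilt.\<close>
  have par: "(1 + real n) *\<^sub>R hyp_lift a \<in> hyp_param_space" for n
    by (rule scaled_hyp_lift_in_hyp_param_space) simp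
  have par1: "hyp_lift a \<in> hyp_param_space" using par[of 0] by simp
  have [measurable]: "g \<in> borel_measurable borel"
    using g by (rule borel_measurable_continuous_onI)
  have cont_\<phi>: "continuous_on UNIV \<phi>"
    unfolding \<phi>_def by (intro continuous_intros continuous_on_minkowski_hyp_lift)
  then have [measurable]: "\<phi> \<in> borel_measurable borel"
    by (rule borel_measurable_continuous_onI)
  have [simp]: "space M = UNIV" and [measurable_cong]: "sets M = sets borel"
    by (simp_all add: M_def)
  interpret prob_space M
    by standard (simp add: M_def emeasure_density nn_integral_hyp_density[OF par1])
  have expect: "expectation h = (LINT x|lborel. h x * hyp_density (hyp_lift a) x)"
    if [measurable]: "h \<in> borel_measurable borel" for h :: "_ \<Rightarrow> real"
    unfolding M_def using hyp_density_pos[OF par1]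
    by (subst integral_density) (auto simp: less_imp_le mult.commute)
  \<comment> \<open>From (1 + n) [m, x] = n + n \<phi>(x) + [m, x], with m =
    \<open>hyp_lift a\<close>: the factor exp (- n) and both normalising constants are absorbed into
    \<open>K\<close>.\<close>
  have tilt: "\<exists>K. \<forall>x. hyp_density ((1 + real n) *\<^sub>R hyp_lift a) x
      = K * (exp (- real n * \<phi> x) * hyp_density (hyp_lift a) x)" for n
  proof -
    define c0 where "c0 = hyp_const CARD('n) 1"
    define c1 where "c1 = hyp_const CARD('n) (1 + real n)"
    have "c0 \<noteq> 0"
      using nn_integral_bessel_K(2)[of 1] by (simp add: c0_def hyp_const_def less_imp_neq[symmetric])
    have norms: "minkowski_norm (hyp_lift a) = 1" "minkowski_norm ((1 + real n) *\<^sub>R hyp_lift a) = 1 + real n"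
      using scaled_hyp_lift_in_hyp_param_space(2)[of 1 a] scaled_hyp_lift_in_hyp_param_space(2)[of "1 + real n" a]
      by simp_all
    have "hyp_density ((1 + real n) *\<^sub>R hyp_lift a) x
        = c1 * exp (- real n) / c0 * (exp (- real n * \<phi> x) * hyp_density (hyp_lift a) x)" for x
    proof -
      have "- ((1 + real n) * minkowski (hyp_lift a) (hyp_lift x))
          = - real n + (- real n * \<phi> x) + (- minkowski (hyp_lift a) (hyp_lift x))"
        by (simp add: \<phi>_def algebra_simps)
      then show ?thesis
        unfolding hyp_density_def norms minkowski_scaleR_left c0_def[symmetric] c1_def[symmetric]
        using \<open>c0 \<noteq> 0\<close> by (simp only: exp_add) simp
    qed
    then show ?thesis by blast
  qed
  have eq: "(LINT x|lborel. g x * hyp_density ((1 + real n) *\<^sub>R hyp_lift a) x)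
      = expectation (\<lambda>x. exp (- real n * \<phi> x) * g x) / expectation (\<lambda>x. exp (- real n * \<phi> x))" for n
  proof -
    obtain K where K: "\<And>x. hyp_density ((1 + real n) *\<^sub>R hyp_lift a) x
        = K * (exp (- real n * \<phi> x) * hyp_density (hyp_lift a) x)"
      using tilt by blast
    have "1 = (LINT x|lborel. hyp_density ((1 + real n) *\<^sub>R hyp_lift a) x)"
      using nn_integral_hyp_density[OF par[of n]] hyp_density_pos[OF par[of n]]
      by (subst integral_eq_nn_integral) (auto simp: less_imp_le)
    also have "\<dots> = K * expectation (\<lambda>x. exp (- real n * \<phi> x))"
      unfolding K by (subst expect) auto
    finally have 1: "K * expectation (\<lambda>x. exp (- real n * \<phi> x)) = 1" ..
    have "(LINT x|lborel. g x * hyp_density ((1 + real n) *\<^sub>R hyp_lift a) x)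
        = (LINT x|lborel. K * ((exp (- real n * \<phi> x) * g x) * hyp_density (hyp_lift a) x))"
      unfolding K by (simp add: mult_ac)
    also have "\<dots> = K * expectation (\<lambda>x. exp (- real n * \<phi> x) * g x)"
      by (subst expect) auto
    finally have 2: "(LINT x|lborel. g x * hyp_density ((1 + real n) *\<^sub>R hyp_lift a) x)
        = K * expectation (\<lambda>x. exp (- real n * \<phi> x) * g x)" .
    have "K = 1 / expectation (\<lambda>x. exp (- real n * \<phi> x))"
      using 1 by (subst nonzero_eq_divide_eq) auto
    then show ?thesis unfolding 2 by simp
  qed
  have "(\<lambda>n. expectation (\<lambda>x. exp (- real n * \<phi> x) * g x) / expectation (\<lambda>x. exp (- real n * \<phi> x)))
      \<longlonglongrightarrow> g a"
  proof (rule tilted_expectation_tendsto[where B = B])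
    show "0 \<le> \<phi> x" for x by (simp add: \<phi>_def minkowski_hyp_lift_ge_1)
    show "\<bar>g x\<bar> \<le> B" for x by (rule bound)
    show "prob {x \<in> space M. \<phi> x < \<delta>} > 0" if "\<delta> > 0" for \<delta>
    proof -
      let ?S = "{x. \<phi> x < \<delta>}"
      have "open ?S" using cont_\<phi> by (intro open_Collect_less) auto
      moreover have "a \<in> ?S" using that by (simp add: \<phi>_def minkowski_hyp_lift_self)
      ultimately have "emeasure lborel ?S > 0" by (rule emeasure_lborel_open_pos)
      \<comment> \<open>The density of \<open>M\<close> is positive everywhere, so a null set of
        \<open>M\<close> is Lebesgue null, which an open set containing \<open>a\<close> is
        not.\<close>
      moreover have "?S \<in> null_sets lborel" if "emeasure M ?S = 0"
      proof -
        have "?S \<in> null_sets M" using that by (intro null_setsI) auto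
        then have "AE x in lborel. x \<in> ?S \<longrightarrow> ennreal (hyp_density (hyp_lift a) x) = 0"
          unfolding M_def by (subst (asm) null_sets_density_iff) auto
        then have "AE x in lborel. x \<notin> ?S"
          using hyp_density_pos[OF par1] by (auto simp: ennreal_eq_0_iff not_le[symmetric] elim!: eventually_mono)
        then show ?thesis by (subst (asm) AE_iff_null_sets[symmetric]) auto
      qed
      ultimately have "emeasure M ?S \<noteq> 0" by (auto simp: null_sets_def)
      then show ?thesis by (simp add: emeasure_eq_measure ennreal_eq_0_iff not_le)
    qed
    \<comment> \<open>Continuity of \<open>g\<close> at \<open>a\<close> gives a Euclidean radius,
      which the separation lemma converts into a threshold for \<phi>.\<close>
    show "\<exists>\<delta>>0. \<forall>x\<in>space M. \<phi> x < \<delta> \<longrightarrow> \<bar>g x - g a\<bar> < \<epsilon>" if "\<epsilon> > 0" for \<epsilon>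
    proof -
      have "\<exists>d>0. \<forall>x. dist x a < d \<longrightarrow> \<bar>g x - g a\<bar> < \<epsilon>"
        using g \<open>\<epsilon> > 0\<close> unfolding continuous_on_iff by (simp add: dist_real_def)
      then obtain d where "d > 0" "\<forall>x. dist x a < d \<longrightarrow> \<bar>g x - g a\<bar> < \<epsilon>" by blast
      then show ?thesis
        using minkowski_hyp_lift_separates[of d a] unfolding \<phi>_def by blast
    qed
  qed measurable
  then show ?thesis unfolding eq .
qed

section \<open>Density of the mixtures\<close>

theorem theorem3:
  assumes "CARD('n::finite) \<ge> 2"
  shows "weak_topology hyperboloid closure_of (hyp_mixtures :: (real \<times> (real ^ 'n)) measure set)
           = borel_probs hyperboloid"
proof
  let ?X = "hyperboloid :: (real \<times> (real ^ 'n)) set"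
  show "weak_topology ?X closure_of hyp_mixtures \<subseteq> borel_probs ?X"
    using closure_of_subset_topspace[of "weak_topology ?X"] by simp
  show "borel_probs ?X \<subseteq> weak_topology ?X closure_of hyp_mixtures"
  proof
    fix M assume M: "M \<in> borel_probs ?X"
    then interpret prob_space M by (simp add: borel_probs_def)
    have sets_M: "sets M = sets (restrict_space borel ?X)" using M by (simp add: borel_probs_def)
    have space_M: "space M = ?X"
      using sets_eq_imp_space_eq[OF sets_M] by (simp add: space_restrict_space)
    \<comment> \<open>The tolerance of a basic neighbourhood inside \<open>T\<close> is split: one
      half for replacing \<open>M\<close> by a finitely supported measure, one half for replacing
      its point masses by hyperboloid distributions.\<close>
    have "\<exists>N\<in>hyp_mixtures. N \<in> T" if T: "openin (weak_topology ?X) T" "M \<in> T" for T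
    proof -
      obtain F :: "(real \<times> (real ^ 'n) \<Rightarrow> real) set" and \<epsilon> :: real where F: "finite F" "\<epsilon> > 0" "\<And>f. f \<in> F \<Longrightarrow> continuous_on ?X f"
          "\<And>f. f \<in> F \<Longrightarrow> bounded (f ` ?X)"
        and nhd: "\<And>N. N \<in> borel_probs ?X \<Longrightarrow>
            (\<forall>f\<in>F. \<bar>(LINT x|N. f x) - (LINT x|M. f x)\<bar> < \<epsilon>) \<Longrightarrow> N \<in> T"
      proof (rule open_weak_topology_nhd[OF T])
        fix F :: "(real \<times> (real ^ 'n) \<Rightarrow> real) set" and \<epsilon> :: real
        assume "finite F" "\<epsilon> > 0" "\<And>f. f \<in> F \<Longrightarrow> continuous_on ?X f" "\<And>f. f \<in> F \<Longrightarrow> bounded (f ` ?X)"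
          "\<And>N. N \<in> borel_probs ?X \<Longrightarrow>
            (\<forall>f\<in>F. \<bar>(LINT x|N. f x) - (LINT x|M. f x)\<bar> < \<epsilon>) \<Longrightarrow> N \<in> T"
        then show thesis by (rule that)
      qed
      have meas: "f \<in> borel_measurable (restrict_space borel ?X)" if "f \<in> F" for f
        using F(3)[OF that] by (rule borel_measurable_continuous_on_restrict)
      have measM: "f \<in> borel_measurable M" if "f \<in> F" for f
        using meas[OF that] measurable_cong_sets[OF sets_M refl] by blast
      obtain k :: nat and w :: "nat \<Rightarrow> real" and x where k: "k \<ge> 1" and w: "\<And>i. i < k \<Longrightarrow> w i \<ge> 0" "(\<Sum>i<k. w i) = 1"
        and x: "\<And>i. i < k \<Longrightarrow> x i \<in> ?X"
        and approx: "\<And>f. f \<in> F \<Longrightarrow> \<bar>(\<Sum>i<k. w i * f (x i)) - (LINT x|M. f x)\<bar> \<le> \<epsilon> / 2"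
      proof (rule finite_sample_approximates_expectations[of F "\<epsilon> / 2"])
        show "finite F" "\<epsilon> / 2 > 0" using F(1,2) by simp_all
        show "f \<in> borel_measurable M" if "f \<in> F" for f using that by (rule measM)
        show "bounded (f ` space M)" if "f \<in> F" for f using F(4)[OF that] by (simp add: space_M)
        fix n :: nat and w :: "nat \<Rightarrow> real" and x
        assume "n \<ge> 1" "\<And>i. i < n \<Longrightarrow> w i \<ge> 0" "(\<Sum>i<n. w i) = 1" "\<And>i. i < n \<Longrightarrow> x i \<in> space M"
          "\<And>f. f \<in> F \<Longrightarrow> \<bar>(\<Sum>i<n. w i * f (x i)) - (LINT x|M. f x)\<bar> \<le> \<epsilon> / 2"
        then show thesis unfolding space_M by (rule that)
      qed
      \<comment> \<open>Since \<open>x i\<close> lies on the hyperboloid it is the lift of its own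
        spatial part, so these parameters move out along the ray through \<open>x i\<close>, and the
        distributions concentrate there.\<close>
      define \<theta> where "\<theta> n i = (1 + real n) *\<^sub>R hyp_lift (snd (x i))" for n i
      have \<theta>: "\<theta> n i \<in> hyp_param_space" for n i
        unfolding \<theta>_def by (rule scaled_hyp_lift_in_hyp_param_space) simp
      have lim: "(\<lambda>n. LINT x|hyp_mixture k w (\<theta> n). f x) \<longlonglongrightarrow> (\<Sum>i<k. w i * f (x i))" if f: "f \<in> F" for f
      proof -
        obtain B where B: "\<And>x. x \<in> ?X \<Longrightarrow> \<bar>f x\<bar> \<le> B"
          using F(4)[OF f] by (auto simp: bounded_iff)
        have "continuous_on UNIV (hyp_lift :: real ^ 'n \<Rightarrow> _)"
          unfolding hyp_lift_def by (intro continuous_intros)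
        then have cont: "continuous_on UNIV (\<lambda>y. f (hyp_lift y))"
          using hyp_lift_in_hyperboloid by (intro continuous_on_compose2[OF F(3)[OF f]]) auto
        have "(\<lambda>n. \<Sum>i<k. w i * (LINT y|lborel. f (hyp_lift y) * hyp_density (\<theta> n i) y))
            \<longlonglongrightarrow> (\<Sum>i<k. w i * f (hyp_lift (snd (x i))))"
          unfolding \<theta>_def
          by (intro tendsto_intros hyp_density_scaled_tendsto[OF cont, where B = B] B hyp_lift_in_hyperboloid)
        moreover have "(\<Sum>i<k. w i * f (hyp_lift (snd (x i)))) = (\<Sum>i<k. w i * f (x i))"
          by (intro sum.cong refl) (simp add: hyp_lift_snd[OF x])
        moreover have "(LINT x|hyp_mixture k w (\<theta> n). f x)
            = (\<Sum>i<k. w i * (LINT y|lborel. f (hyp_lift y) * hyp_density (\<theta> n i) y))" for n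
          using \<theta> w(1) meas[OF f] B by (rule integral_hyp_mixture)
        ultimately show ?thesis by simp
      qed
      \<comment> \<open>Finiteness of \<open>F\<close> lets a single n serve all test
        functions.\<close>
      have "\<forall>f\<in>F. \<forall>\<^sub>F n in sequentially.
          \<bar>(LINT x|hyp_mixture k w (\<theta> n). f x) - (\<Sum>i<k. w i * f (x i))\<bar> < \<epsilon> / 2"
        using tendstoD[OF lim half_gt_zero[OF F(2)]] unfolding dist_real_def by blast
      then have "\<forall>\<^sub>F n in sequentially. \<forall>f\<in>F.
          \<bar>(LINT x|hyp_mixture k w (\<theta> n). f x) - (\<Sum>i<k. w i * f (x i))\<bar> < \<epsilon> / 2"
        using F(1) by (rule eventually_ball_finite[rotated])
      then obtain n where n: "\<And>f. f \<in> F \<Longrightarrow>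
          \<bar>(LINT x|hyp_mixture k w (\<theta> n). f x) - (\<Sum>i<k. w i * f (x i))\<bar> < \<epsilon> / 2"
        unfolding eventually_sequentially by blast
      let ?N = "hyp_mixture k w (\<theta> n)"
      have "?N \<in> borel_probs ?X"
        using prob_space_hyp_mixture[of k "\<theta> n" w] \<theta> w by (simp add: borel_probs_def)
      moreover have "\<bar>(LINT x|?N. f x) - (LINT x|M. f x)\<bar> < \<epsilon>" if "f \<in> F" for f
        using n[OF that] approx[OF that] by linarith
      ultimately have "?N \<in> T" using nhd by blast
      moreover have "?N \<in> hyp_mixtures" unfolding hyp_mixtures_def using k w \<theta> by blast
      ultimately show ?thesis by blast
    qed
    then show "M \<in> weak_topology ?X closure_of hyp_mixtures"
      unfolding in_closure_of using M by auto
  qed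
qed

end
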